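(* Let $\alpha=\alpha_0+\sum_{\iota\in I}\alpha_\iota$ be a gauged poly-$\log$-homogeneous distribution. Then $$\begin{aligned} \zeta(\alpha)(z)=&\sum_{\iota\in I_0}\sum_{n=0}^{l_\iota}\frac{(-1)^{l_\iota+1}\,l_\iota!\,\int_M\partial^n\tilde\alpha_\iota(0)\,d\mathrm{vol}_M}{n!\,z^{l_\iota+1-n}}+\sum_{n\in\mathbb{N}_0}\frac{\int_{\mathbb{R}_{\ge1}\times M}\partial^n\alpha_0(0)\,d\mathrm{vol}_{\mathbb{R}_{\ge1}\times M}}{n!}z^n\\ &+\sum_{n\in\mathbb{N}_0}\sum_{\iota\in I\setminus I_0}\sum_{j=0}^n\frac{(-1)^{l_\iota+j+1}(l_\iota+j)!\,\int_M\partial^{n-j}\tilde\alpha_\iota(0)\,d\mathrm{vol}_M}{n!\,(\dim M+d_\iota+1)^{l_\iota+j+1}}z^n\\ &+\sum_{n\in\mathbb{N}_0}\sum_{\iota\in I_0}\frac{(-1)^{l_\iota+1}\,l_\iota!\,\int_M\partial^{n+l_\iota+1}\tilde\alpha_\iota(0)\,d\mathrm{vol}_M}{(n+l_\iota+1)!}z^n \end{aligned}$$ holds in a sufficiently small neighborhood of zero. In particular, if $\alpha$ is poly-homogeneous, then $$\begin{aligned} \zeta(\alpha)(z)=&\sum_{\iota\in I_0}\frac{-\int_M\alpha_\iota(0)\,d\mathrm{vol}_M}{z}+\sum_{n\in\mathbb{N}_0}\frac{\int_{\mathbb{R}_{\ge1}\times M}\partial^n\alpha_0(0)\,d\mathrm{vol}_{\mathbb{R}_{\ge1}\times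 M}}{n!}z^n\\ &+\sum_{n\in\mathbb{N}_0}\sum_{\iota\in I\setminus I_0}\sum_{j=0}^n\frac{(-1)^{j+1}j!\,\int_M\partial^{n-j}\alpha_\iota(0)\,d\mathrm{vol}_M}{n!\,(\dim M+d_\iota+1)^{j+1}}z^n+\sum_{n\in\mathbb{N}_0}\sum_{\iota\in I_0}\frac{-\int_M\partial^{n+1}\alpha_\iota(0)\,d\mathrm{vol}_M}{(n+1)!}z^n \end{aligned}$$ in a sufficiently small neighborhood of zero.
   Context: Let $M$ be an orientable, compact, finite-dimensional manifold without boundary, with volume measure $d\mathrm{vol}_M$; $\mathbb{R}_{\ge1}\times M$ carries the measure $d\mathrm{vol}_{\mathbb{R}_{\ge1}\times M}(r,\nu)=r^{\dim M}\,dr\,d\mathrm{vol}_M(\nu)$. $\partial^n$ denotes the $n$-th derivative in the complex parameter $z$. A gauged poly-$\log$-homogeneous distribution is a holomorphic family $\alpha$ (in $z$) of functions on $\mathbb{R}_{\ge1}\times M$ given by an expansion (an actual identity, not an asymptotic one) $\alpha=\alpha_0+\sum_{\iota\in I}\alpha_\iota$, $I\subseteq\mathbb{N}$, such that: (1) $\alpha_0(z)\in L_1(\mathbb{R}_{\ge1}\times M)$ for $z$ in an open neighborhood of $\{z\in\mathbb{C};\ \mathrm{Re}\,z\le0\}$; (2) each $\alpha_\iota(z)$ is $\log$-homogeneous with degree of homogeneity $d_\iota+z$, $d_\iota\in\mathbb{C}$, and logarithmic order $l_\iota\in\mathbb{N}_0$, i.e. $\alpha_\iota(z)(r,\nu)=r^{d_\iota+z}(\ln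 r)^{l_\iota}\tilde\alpha_\iota(z)(\nu)$ for some function $\tilde\alpha_\iota(z)$ on $M$; (3) $(\mathrm{Re}\,d_\iota)_{\iota\in I}$ is bounded from above; (4) $\iota\mapsto(d_\iota,l_\iota)$ is injective; (5) for each $d\in\mathbb{C}$ only finitely many $\iota$ satisfy $d_\iota=d$; (6) $((d_\iota-\delta)^{-1})_{\iota\in I}\in\ell_2(I)$ for every $\delta\in\mathbb{C}\setminus\{d_\iota;\ \iota\in I\}$; (7) each $\sum_{\iota\in I}\tilde\alpha_\iota(z)$ converges unconditionally in $L_1(M)$. It is poly-homogeneous if all $l_\iota=0$; integrals over $M$ of $\alpha_\iota(0)$ and of $\partial^k\alpha_\iota(0)$ are integrals of the restrictions to $r=1$. The $\zeta$-function $\zeta(\alpha)$ is the meromorphic extension of $z\mapsto\int_{\mathbb{R}_{\ge1}\times M}\alpha(z)\,d\mathrm{vol}_{\mathbb{R}_{\ge1}\times M}$, i.e. $\zeta(\alpha)(z)=\int_{\mathbb{R}_{\ge1}\times M}\alpha_0(z)\,d\mathrm{vol}_{\mathbb{R}_{\ge1}\times M}+\sum_{\iota\in I}\frac{(-1)^{l_\iota+1}l_\iota!\,\mathrm{res}\,\alpha_\iota(z)}{(\dim M+d_\iota+z+1)^{l_\iota+1}}$ with $\mathrm{res}\,\alpha_\iota(z):=\int_M\tilde\alpha_\iota(z)\,d\mathrm{vol}_M$. $I_0:=\{\iota\in I;\ d_\iota=-\dim M-1\}$.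
   Formalization: The missing factor "n choose j" is inserted in the sums over I∖I_0 (the printed formula fails from n=2 on), and the series defining ζ(α) is assumed to converge unconditionally, uniformly on compact sets avoiding the poles, which (1)–(7) do not imply. *)

theory Defs
  imports "HOL-Analysis.Analysis"
begin

section \<open>Closed oriented manifolds with a volume measure\<close>

text \<open>
  Charts take values in \<^term>\<open>Euclidean_space D\<close>, i.e. in the functions \<open>nat \<Rightarrow> real\<close> that vanish
  at all indices \<open>\<ge> D\<close>. This keeps the dimension an ordinary natural number; \<open>D = 0\<close> is allowed.
\<close>

definition partial_deriv :: "nat \<Rightarrow> ((nat \<Rightarrow> real) \<Rightarrow> real) \<Rightarrow> (nat \<Rightarrow> real) \<Rightarrow> real" where
  "partial_deriv i f x = deriv (\<lambda>t. f (x(i := t))) (x i)"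

primrec Ck_on :: "nat \<Rightarrow> nat \<Rightarrow> (nat \<Rightarrow> real) set \<Rightarrow> ((nat \<Rightarrow> real) \<Rightarrow> real) \<Rightarrow> bool" where
  "Ck_on D 0 W f \<longleftrightarrow> continuous_on W f"
| "Ck_on D (Suc k) W f \<longleftrightarrow> continuous_on W f \<and>
     (\<forall>i<D. (\<forall>x\<in>W. (\<lambda>t. f (x(i := t))) field_differentiable at (x i)) \<and>
            Ck_on D k W (partial_deriv i f))"

definition smooth_on :: "nat \<Rightarrow> (nat \<Rightarrow> real) set \<Rightarrow> ((nat \<Rightarrow> real) \<Rightarrow> real) \<Rightarrow> bool" where
  "smooth_on D W f \<longleftrightarrow> (\<forall>k. Ck_on D k W f)"

text \<open>Leibniz formula for the determinant of the matrix of partial derivatives.\<close>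

definition jacobian_det ::
    "nat \<Rightarrow> ((nat \<Rightarrow> real) \<Rightarrow> (nat \<Rightarrow> real)) \<Rightarrow> (nat \<Rightarrow> real) \<Rightarrow> real" where
  "jacobian_det D \<tau> x =
     (\<Sum>p | p permutes {..<D}. of_int (sign p) * (\<Prod>i<D. partial_deriv (p i) (\<lambda>y. \<tau> y i) x))"

definition is_chart :: "nat \<Rightarrow> 'm::topological_space set \<Rightarrow> ('m \<Rightarrow> nat \<Rightarrow> real) \<Rightarrow> bool" where
  "is_chart D V \<phi> \<longleftrightarrow> open V \<and> inj_on \<phi> V \<and> openin (Euclidean_space D) (\<phi> ` V) \<and>
     homeomorphism V (\<phi> ` V) \<phi> (inv_into V \<phi>)"

definition oriented_compatible ::
    "nat \<Rightarrow> 'm set \<Rightarrow> ('m \<Rightarrow> nat \<Rightarrow> real) \<Rightarrow> 'm set \<Rightarrow> ('m \<Rightarrow> nat \<Rightarrow> real) \<Rightarrow> bool" where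
  "oriented_compatible D V \<phi> V' \<phi>' \<longleftrightarrow>
     (let \<tau> = \<phi>' \<circ> inv_into V \<phi>; W = \<phi> ` (V \<inter> V') in
       (\<forall>i<D. smooth_on D W (\<lambda>x. \<tau> x i)) \<and> (\<forall>x\<in>W. jacobian_det D \<tau> x > 0))"

text \<open>
  The manifold is the whole type \<open>'m\<close>. Second countability need not be required, since it follows
  from compactness. A smooth manifold is orientable iff its smooth structure has such an atlas.
\<close>

definition compact_oriented_manifold ::
    "nat \<Rightarrow> ('m::t2_space set \<times> ('m \<Rightarrow> nat \<Rightarrow> real)) set \<Rightarrow> bool" where
  "compact_oriented_manifold D \<A> \<longleftrightarrow>
     compact (UNIV :: 'm set) \<and>
     (\<forall>(V, \<phi>)\<in>\<A>. is_chart D V \<phi>) \<and>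
     (\<Union>(V, \<phi>)\<in>\<A>. V) = UNIV \<and>
     (\<forall>(V, \<phi>)\<in>\<A>. \<forall>(V', \<phi>')\<in>\<A>. oriented_compatible D V \<phi> V' \<phi>')"

definition lebesgue_Rn :: "nat \<Rightarrow> (nat \<Rightarrow> real) measure" where
  "lebesgue_Rn D =
     distr (\<Pi>\<^sub>M i\<in>{..<D}. lborel) borel (\<lambda>x i. if i < D then x i else 0)"

text \<open>
  The measure of a nowhere vanishing smooth top-degree form: in every chart it has a smooth positive
  density with respect to Lebesgue measure. Riemannian volume measures are of this kind.
\<close>

definition volume_measure ::
    "nat \<Rightarrow> ('m::t2_space set \<times> ('m \<Rightarrow> nat \<Rightarrow> real)) set \<Rightarrow> 'm measure \<Rightarrow> bool" where
  "volume_measure D \<A> vol \<longleftrightarrow>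
     sets vol = sets borel \<and>
     (\<forall>(V, \<phi>)\<in>\<A>. \<exists>\<rho>. smooth_on D (\<phi> ` V) \<rho> \<and> (\<forall>x\<in>\<phi> ` V. \<rho> x > 0) \<and>
        (\<forall>B\<in>sets borel. B \<subseteq> V \<longrightarrow>
           emeasure vol B = (\<integral>\<^sup>+x. ennreal (\<rho> x) * indicator (\<phi> ` B) x \<partial>lebesgue_Rn D)))"

text \<open>The measure \<open>r\<^sup>D dr dvol\<close> on \<open>[1,\<infinity>) \<times> M\<close>.\<close>

definition cone_measure :: "nat \<Rightarrow> 'm measure \<Rightarrow> (real \<times> 'm) measure" where
  "cone_measure D vol =
     density (restrict_space lborel {1..} \<Otimes>\<^sub>M vol) (\<lambda>(r, \<nu>). ennreal (r ^ D))"


section \<open>Holomorphic families in \<open>L\<^sub>1\<close>\<close>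

definition tendsto_L1 ::
    "'x measure \<Rightarrow> ('i \<Rightarrow> 'x \<Rightarrow> complex) \<Rightarrow> ('x \<Rightarrow> complex) \<Rightarrow> 'i filter \<Rightarrow> bool" where
  "tendsto_L1 N f g F \<longleftrightarrow>
     integrable N g \<and> (\<forall>\<^sub>F i in F. integrable N (f i)) \<and>
     ((\<lambda>i. \<integral>x. norm (f i x - g x) \<partial>N) \<longlongrightarrow> 0) F"

definition has_L1_derivative ::
    "'x measure \<Rightarrow> (complex \<Rightarrow> 'x \<Rightarrow> complex) \<Rightarrow> ('x \<Rightarrow> complex) \<Rightarrow> complex \<Rightarrow> bool" where
  "has_L1_derivative N f g z \<longleftrightarrow> tendsto_L1 N (\<lambda>w x. (f w x - f z x) / (w - z)) g (at z)"

definition L1_holomorphic_on ::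
    "'x measure \<Rightarrow> (complex \<Rightarrow> 'x \<Rightarrow> complex) \<Rightarrow> complex set \<Rightarrow> bool" where
  "L1_holomorphic_on N f U \<longleftrightarrow>
     (\<forall>z\<in>U. integrable N (f z) \<and> (\<exists>g. has_L1_derivative N f g z))"

text \<open>
  \<^term>\<open>(L1_deriv N ^^ n) f z\<close> is the \<open>n\<close>-th derivative in the parameter \<open>z\<close>. It is an arbitrary
  representative of its a.e.-class; only its integrals are used below.
\<close>

definition L1_deriv :: "'x measure \<Rightarrow> (complex \<Rightarrow> 'x \<Rightarrow> complex) \<Rightarrow> complex \<Rightarrow> 'x \<Rightarrow> complex" where
  "L1_deriv N f z = (SOME g. has_L1_derivative N f g z)"


section \<open>Gauged poly-log-homogeneous distributions\<close>

text \<open>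
  The parameter \<open>U\<close> is the open neighbourhood of the closed left half-plane on which the family lives,
  \<open>\<alpha>s \<iota>\<close> is the \<open>\<iota>\<close>-th log-homogeneous part and \<open>\<alpha>t \<iota>\<close> its angular factor. Limits along
  \<^term>\<open>finite_subsets_at_top I\<close> express unconditional convergence. The expansion holds in
  \<open>L\<^sub>1(M)\<close> for each fixed \<open>r\<close>; \<open>\<alpha>0\<close> is subtracted because a slice of an \<open>L\<^sub>1\<close> function need not be
  integrable for every \<open>r\<close>.
\<close>

locale gauged_poly_log_homogeneous =
  fixes D :: nat
    and vol :: "'m measure"
    and U :: "complex set"
    and \<alpha> \<alpha>0 :: "complex \<Rightarrow> real \<times> 'm \<Rightarrow> complex"
    and I :: "nat set"
    and \<alpha>s :: "nat \<Rightarrow> complex \<Rightarrow> real \<times> 'm \<Rightarrow> complex"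
    and d :: "nat \<Rightarrow> complex"
    and l :: "nat \<Rightarrow> nat"
    and \<alpha>t :: "nat \<Rightarrow> complex \<Rightarrow> 'm \<Rightarrow> complex"
  assumes open_domain: "open U"
    and left_half_plane: "{z. Re z \<le> 0} \<subseteq> U"
    and expansion: "\<And>z r. z \<in> U \<Longrightarrow> r \<ge> 1 \<Longrightarrow>
          tendsto_L1 vol (\<lambda>F \<nu>. \<Sum>\<iota>\<in>F. \<alpha>s \<iota> z (r, \<nu>)) (\<lambda>\<nu>. \<alpha> z (r, \<nu>) - \<alpha>0 z (r, \<nu>))
            (finite_subsets_at_top I)"
    and holomorphic_expansion: "\<And>r. r \<ge> 1 \<Longrightarrow>
          L1_holomorphic_on vol (\<lambda>z \<nu>. \<alpha> z (r, \<nu>) - \<alpha>0 z (r, \<nu>)) U"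
    and holomorphic_L1_part: "L1_holomorphic_on (cone_measure D vol) \<alpha>0 U"
    and holomorphic_angular: "\<And>\<iota>. \<iota> \<in> I \<Longrightarrow> L1_holomorphic_on vol (\<alpha>t \<iota>) U"
    and log_homogeneous: "\<And>\<iota> z r \<nu>. \<iota> \<in> I \<Longrightarrow> z \<in> U \<Longrightarrow> r \<ge> 1 \<Longrightarrow>
          \<alpha>s \<iota> z (r, \<nu>) = of_real r powr (d \<iota> + z) * of_real (ln r) ^ l \<iota> * \<alpha>t \<iota> z \<nu>"
    and degrees_bounded: "bdd_above ((\<lambda>\<iota>. Re (d \<iota>)) ` I)"
    and degrees_inj: "inj_on (\<lambda>\<iota>. (d \<iota>, l \<iota>)) I"
    and degrees_finite: "\<And>c. finite {\<iota>\<in>I. d \<iota> = c}"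
    and degrees_l2: "\<And>\<delta>. \<delta> \<notin> d ` I \<Longrightarrow> (\<lambda>\<iota>. (norm (inverse (d \<iota> - \<delta>)))\<^sup>2) summable_on I"
    and angular_unconditional: "\<And>z. z \<in> U \<Longrightarrow>
          \<exists>S. tendsto_L1 vol (\<lambda>F \<nu>. \<Sum>\<iota>\<in>F. \<alpha>t \<iota> z \<nu>) S (finite_subsets_at_top I)"

definition residue_term ::
    "nat \<Rightarrow> 'm measure \<Rightarrow> (nat \<Rightarrow> complex) \<Rightarrow> (nat \<Rightarrow> nat) \<Rightarrow> (nat \<Rightarrow> complex \<Rightarrow> 'm \<Rightarrow> complex)
     \<Rightarrow> nat \<Rightarrow> complex \<Rightarrow> complex" where
  "residue_term D vol d l \<alpha>t \<iota> z =
     (-1) ^ (l \<iota> + 1) * fact (l \<iota>) * (\<integral>\<nu>. \<alpha>t \<iota> z \<nu> \<partial>vol)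
       / (of_nat D + d \<iota> + z + 1) ^ (l \<iota> + 1)"

definition zeta ::
    "nat \<Rightarrow> 'm measure \<Rightarrow> (complex \<Rightarrow> real \<times> 'm \<Rightarrow> complex) \<Rightarrow> nat set \<Rightarrow> (nat \<Rightarrow> complex)
     \<Rightarrow> (nat \<Rightarrow> nat) \<Rightarrow> (nat \<Rightarrow> complex \<Rightarrow> 'm \<Rightarrow> complex) \<Rightarrow> complex \<Rightarrow> complex" where
  "zeta D vol \<alpha>0 I d l \<alpha>t z =
     (\<integral>x. \<alpha>0 z x \<partial>cone_measure D vol) + (\<Sum>\<^sub>\<infinity>\<iota>\<in>I. residue_term D vol d l \<alpha>t \<iota> z)"

text \<open>
  The series above has to define a meromorphic function for the \<open>\<zeta>\<close>-function to exist. As usual for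
  series of meromorphic functions this means unconditional convergence, uniform on compact sets
  that avoid the poles. Pointwise convergence would not make the sum meromorphic, and with unbounded
  logarithmic orders the factors \<open>l \<iota>!\<close> can make the series diverge.
\<close>

definition zeta_series_converges ::
    "nat \<Rightarrow> 'm measure \<Rightarrow> complex set \<Rightarrow> nat set \<Rightarrow> (nat \<Rightarrow> complex)
     \<Rightarrow> (nat \<Rightarrow> nat) \<Rightarrow> (nat \<Rightarrow> complex \<Rightarrow> 'm \<Rightarrow> complex) \<Rightarrow> bool" where
  "zeta_series_converges D vol U I d l \<alpha>t \<longleftrightarrow>
     (\<forall>K. compact K \<and> K \<subseteq> U - (\<lambda>\<iota>. - (of_nat D + d \<iota> + 1)) ` I \<longrightarrow>
        uniform_limit K (\<lambda>F z. \<Sum>\<iota>\<in>F. residue_term D vol d l \<alpha>t \<iota> z)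
          (\<lambda>z. \<Sum>\<^sub>\<infinity>\<iota>\<in>I. residue_term D vol d l \<alpha>t \<iota> z) (finite_subsets_at_top I))"

text \<open>The index set \<open>I\<^sub>0\<close>, whose terms have their pole at \<open>0\<close>.\<close>

definition critical_indices :: "nat \<Rightarrow> nat set \<Rightarrow> (nat \<Rightarrow> complex) \<Rightarrow> nat set" where
  "critical_indices D I d = {\<iota>\<in>I. d \<iota> = - of_nat D - 1}"

text \<open>
  A remark on the Laurent coefficients of the \<open>\<zeta>\<close>-function at \<open>0\<close>: by the Leibniz rule, the \<open>n\<close>-th
  Taylor coefficient of a \<^const>\<open>residue_term\<close> without pole at \<open>0\<close> contains the binomial
  coefficients \<open>n choose j\<close>. These are missing in the formula as printed in the literature, which
  fails without them from \<open>n = 2\<close> on, e.g. for a single noncritical index with \<open>l = 0\<close> and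
  \<open>\<alpha>t z \<nu> = exp z\<close>.
\<close>

end

theory Submission
  imports Defs "HOL-Complex_Analysis.Complex_Analysis"
begin

text \<open>
  A holomorphic function with values in \<open>L\<^sub>1\<close> is infinitely differentiable, since pairing it with
  measurable functions bounded by \<open>1\<close> gives scalar holomorphic functions that satisfy the Cauchy estimates
  uniformly; hence integration commutes with all derivatives in the parameter. By the \<open>\<ell>\<^sub>2\<close> condition
  on the degrees, the noncritical poles stay away from zero. The noncritical part of the series converges
  uniformly on a small circle around zero, hence by the maximum principle on the disc, where the Weierstrass
  convergence theorem and the Leibniz rule give its Taylor coefficients. The finitely many critical terms
  are quotients of power series by powers of \<open>z\<close>.
\<close>

section \<open>Convergence in \<open>L\<^sub>1\<close>\<close>

text \<open>\<open>L1_holomorphic_on\<close> grants a single derivative, represented by functions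
  chosen up to null sets, so even the second derivative has to be constructed. The constants in the
  Cauchy estimates for the scalar pairings depend on a bound for the L1 norm and on the radius, not
  on the function paired with; duality therefore turns them back into L1 estimates, and completeness
  supplies the limit. The series poses a different obstacle. Its convergence is assumed on compact
  sets that avoid all pole positions, and zero is one of them as soon as
  \<open>critical_indices\<close> is nonempty. Hence a circle, not a disc, is the set to start from,
  and convergence inside it is recovered only after the critical terms are removed. The coefficients
  \<open>c\<close> begin with the derivative of order \<open>l \<iota> + 1\<close> because the lower
  ones form the principal part.\<close>

lemma AE_summable_norm:
  fixes v :: "nat \<Rightarrow> 'x \<Rightarrow> complex"
  assumes int: "\<And>n. integrable N (v n)"
    and sm: "summable (\<lambda>n. \<integral>x. norm (v n x) \<partial>N)"
  shows "AE x in N. summable (\<lambda>n. norm (v n x))"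
proof -
  have [measurable]: "v n \<in> borel_measurable N" for n
    using int by auto
  have "(\<integral>\<^sup>+x. (\<Sum>n. ennreal (norm (v n x))) \<partial>N) = (\<Sum>n. \<integral>\<^sup>+x. ennreal (norm (v n x)) \<partial>N)"
    by (rule nn_integral_suminf) measurable
  also have "\<dots> = (\<Sum>n. ennreal (\<integral>x. norm (v n x) \<partial>N))"
    by (simp add: nn_integral_eq_integral int)
  also have "(\<Sum>n. ennreal (\<integral>x. norm (v n x) \<partial>N)) \<noteq> \<infinity>"
    unfolding infinity_ennreal_def by (rule ennreal_suminf_neq_top[OF sm]) auto
  finally have fin: "(\<integral>\<^sup>+x. (\<Sum>n. ennreal (norm (v n x))) \<partial>N) \<noteq> \<infinity>" .
  have "AE x in N. (\<Sum>n. ennreal (norm (v n x))) \<noteq> \<infinity>"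
    by (rule nn_integral_PInf_AE[OF _ fin]) measurable
  then show ?thesis
    by eventually_elim (simp add: summable_suminf_not_top)
qed

text \<open>Completeness of L1 in Riesz-Fischer form: the telescoping series of increments converges
  absolutely almost everywhere, and the sum of the norms is an integrable majorant. It later
  produces a derivative whose value is not known beforehand.\<close>

lemma tendsto_L1_summable_increments:
  fixes u :: "nat \<Rightarrow> 'x \<Rightarrow> complex"
  assumes int: "\<And>n. integrable N (u n)"
    and sm: "summable (\<lambda>n. \<integral>x. norm (u (Suc n) x - u n x) \<partial>N)"
  obtains g where "tendsto_L1 N u g sequentially"
proof -
  define v where "v n x = u (Suc n) x - u n x" for n x
  have intv: "integrable N (v n)" for n
    unfolding v_def by (intro Bochner_Integration.integrable_diff int)
  have smv: "summable (\<lambda>n. \<integral>x. norm (v n x) \<partial>N)"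
    using sm by (simp add: v_def)
  have ae: "AE x in N. summable (\<lambda>n. norm (v n x))"
    by (rule AE_summable_norm[OF intv smv])
  define W where "W x = (\<Sum>n. norm (v n x))" for x
  have intW: "integrable N W"
    unfolding W_def by (rule integrable_suminf) (use intv ae smv in auto)
  define g where "g x = u 0 x + (\<Sum>n. v n x)" for x
  have intg: "integrable N g"
    unfolding g_def
    by (intro Bochner_Integration.integrable_add int integrable_suminf intv ae smv)
  have [measurable]: "u n \<in> borel_measurable N" "g \<in> borel_measurable N" for n
    using int intg by auto
  have tel: "u n x - g x = (\<Sum>i<n. v i x) - (\<Sum>i. v i x)" for n x
    using sum_lessThan_telescope[of "\<lambda>i. u i x" n] by (simp add: g_def v_def)
  have lim: "AE x in N. (\<lambda>n. norm (u n x - g x)) \<longlonglongrightarrow> 0"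
    using ae
  proof eventually_elim
    case (elim x)
    then have "(\<lambda>n. \<Sum>i<n. v i x) \<longlonglongrightarrow> (\<Sum>i. v i x)"
      by (rule summable_LIMSEQ[OF summable_norm_cancel])
    then show ?case
      unfolding tel by (rule tendsto_norm_zero[OF LIM_zero])
  qed
  \<comment> \<open>The partial sum and the full sum are each bounded by \<open>W\<close>, whence
    the factor 2.\<close>
  have bound: "AE x in N. norm (norm (u n x - g x)) \<le> 2 * W x" for n
    using ae
  proof eventually_elim
    case (elim x)
    have "norm (\<Sum>i<n. v i x) \<le> (\<Sum>i<n. norm (v i x))"
      by (rule norm_sum)
    also have "(\<Sum>i<n. norm (v i x)) \<le> (\<Sum>i. norm (v i x))"
      using elim by (rule sum_le_suminf) auto
    finally have "norm (\<Sum>i<n. v i x) \<le> W x"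
      by (simp add: W_def)
    moreover have "norm (\<Sum>i. v i x) \<le> W x"
      unfolding W_def by (rule summable_norm[OF elim])
    ultimately show ?case
      unfolding tel using norm_triangle_ineq4[of "\<Sum>i<n. v i x" "\<Sum>i. v i x"] by simp
  qed
  have "(\<lambda>n. \<integral>x. norm (u n x - g x) \<partial>N) \<longlonglongrightarrow> (\<integral>x. 0 \<partial>N)"
    by (rule integral_dominated_convergence[OF _ _ _ lim bound]) (use intW in auto)
  then have "tendsto_L1 N u g sequentially"
    unfolding tendsto_L1_def using int intg by simp
  then show ?thesis
    by (rule that)
qed

section \<open>Holomorphic families with values in \<open>L\<^sub>1\<close>\<close>

lemma integrable_bounded_mult:
  fixes f h :: "'x \<Rightarrow> complex"
  assumes "integrable N f" and [measurable]: "h \<in> borel_measurable N" and "\<And>x. norm (h x) \<le> 1"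
  shows "integrable N (\<lambda>x. h x * f x)"
proof (rule Bochner_Integration.integrable_bound[OF assms(1)])
  have [measurable]: "f \<in> borel_measurable N"
    using assms(1) by auto
  show "(\<lambda>x. h x * f x) \<in> borel_measurable N"
    by measurable
  show "AE x in N. norm (h x * f x) \<le> norm (f x)"
    using assms(3) by (auto simp: norm_mult intro!: mult_left_le_one_le)
qed

lemma norm_integral_bounded_mult_le:
  fixes f h :: "'x \<Rightarrow> complex"
  assumes "integrable N f" "h \<in> borel_measurable N" "\<And>x. norm (h x) \<le> 1"
  shows "norm (\<integral>x. h x * f x \<partial>N) \<le> (\<integral>x. norm (f x) \<partial>N)"
proof (rule order_trans[OF integral_norm_bound])
  show "(\<integral>x. norm (h x * f x) \<partial>N) \<le> (\<integral>x. norm (f x) \<partial>N)"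
    using assms
    by (intro integral_mono integrable_norm integrable_bounded_mult)
      (auto simp: norm_mult intro!: mult_left_le_one_le)
qed

text \<open>The conjugate phase of \<open>f\<close> attains the supremum in the duality between L1
  and bounded functions, so an estimate valid for all pairings is an estimate of the norm.\<close>

lemma L1_norm_eq_pairing:
  fixes f :: "'x \<Rightarrow> complex"
  assumes "integrable N f"
  obtains h where "h \<in> borel_measurable N" "\<And>x. norm (h x) \<le> 1"
    "(\<integral>x. h x * f x \<partial>N) = of_real (\<integral>x. norm (f x) \<partial>N)"
proof
  have [measurable]: "f \<in> borel_measurable N"
    using assms by auto
  \<comment> \<open>At zeros of \<open>f\<close> the quotient is 0 by convention, which agrees with
    both the bound 1 and the product formula.\<close>
  let ?h = "\<lambda>x. cnj (f x) / of_real (norm (f x))"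
  have [measurable]: "(\<lambda>x. cnj (f x)) \<in> borel_measurable N" "(\<lambda>x. complex_of_real (norm (f x))) \<in> borel_measurable N"
    by (rule measurable_compose[where N = borel and f = f], simp,
        intro borel_measurable_continuous_onI continuous_intros)+
  show "?h \<in> borel_measurable N"
    by measurable
  show "norm (?h x) \<le> 1" for x
    by (simp add: norm_divide)
  have "?h x * f x = of_real (norm (f x))" for x
    using complex_norm_square[of "f x"] by (cases "f x = 0") (auto simp: field_simps power2_eq_square)
  then show "(\<integral>x. ?h x * f x \<partial>N) = of_real (\<integral>x. norm (f x) \<partial>N)"
    by simp
qed

lemma L1_holomorphic_onD:
  assumes "L1_holomorphic_on N f U" "z \<in> U"
  shows "integrable N (f z)" and "has_L1_derivative N f (L1_deriv N f z) z"
    and "integrable N (L1_deriv N f z)"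
proof -
  show "integrable N (f z)"
    using assms by (auto simp: L1_holomorphic_on_def)
  show *: "has_L1_derivative N f (L1_deriv N f z) z"
    using assms unfolding L1_holomorphic_on_def L1_deriv_def by (metis someI_ex)
  show "integrable N (L1_deriv N f z)"
    using * by (simp add: has_L1_derivative_def tendsto_L1_def)
qed

text \<open>Pairing with \<open>h\<close> is linear of norm at most 1, so the error of the scalar
  difference quotient is dominated by the error in L1.\<close>

lemma has_field_derivative_pairing:
  assumes f: "L1_holomorphic_on N f U" and U: "open U" and z: "z \<in> U"
    and h: "h \<in> borel_measurable N" "\<And>x. norm (h x) \<le> 1"
  shows "((\<lambda>z. \<integral>x. h x * f z x \<partial>N) has_field_derivative (\<integral>x. h x * L1_deriv N f z x \<partial>N)) (at z)"
proof -
  let ?g = "L1_deriv N f z"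
  let ?q = "\<lambda>w x. (f w x - f z x) / (w - z)"
  have lim: "((\<lambda>w. \<integral>x. norm (?q w x - ?g x) \<partial>N) \<longlongrightarrow> 0) (at z)"
    and ev: "\<forall>\<^sub>F w in at z. integrable N (?q w)"
    using L1_holomorphic_onD(2)[OF f z] by (auto simp: has_L1_derivative_def tendsto_L1_def)
  have intg: "integrable N ?g"
    by (rule L1_holomorphic_onD(3)[OF f z])
  have "\<forall>\<^sub>F w in at z. w \<in> U"
    using U z by (rule eventually_at_in_open')
  then have "\<forall>\<^sub>F w in at z. norm (((\<integral>x. h x * f w x \<partial>N) - (\<integral>x. h x * f z x \<partial>N)) / (w - z) - (\<integral>x. h x * ?g x \<partial>N))
      \<le> (\<integral>x. norm (?q w x - ?g x) \<partial>N)"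
    using ev
  proof eventually_elim
    case (elim w)
    have i: "integrable N (\<lambda>x. h x * f w x)" "integrable N (\<lambda>x. h x * f z x)" "integrable N (\<lambda>x. h x * ?g x)"
      by (intro integrable_bounded_mult h L1_holomorphic_onD(1)[OF f] elim z intg)+
    have "((\<integral>x. h x * f w x \<partial>N) - (\<integral>x. h x * f z x \<partial>N)) / (w - z) - (\<integral>x. h x * ?g x \<partial>N)
        = (\<integral>x. (h x * f w x - h x * f z x) / (w - z) - h x * ?g x \<partial>N)"
      using i by simp
    also have "\<dots> = (\<integral>x. h x * (?q w x - ?g x) \<partial>N)"
      by (rule Bochner_Integration.integral_cong) (auto simp: algebra_simps diff_divide_distrib)
    also have "norm \<dots> \<le> (\<integral>x. norm (?q w x - ?g x) \<partial>N)"
      by (intro norm_integral_bounded_mult_le h Bochner_Integration.integrable_diff elim intg)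
    finally show ?case .
  qed
  from Lim_null_comparison[OF this lim]
  show ?thesis
    by (simp add: has_field_derivative_iff LIM_zero_iff)
qed

text \<open>Differentiability in L1 implies continuity in L1: the increment is \<open>w - z\<close>
  times a quotient whose norm stays bounded near \<open>z\<close>. The resulting \<open>B\<close>
  bounds all pairings at once.\<close>

lemma L1_norm_bounded_on_compact:
  assumes f: "L1_holomorphic_on N f U" and U: "open U" and K: "compact K" "K \<subseteq> U"
  obtains B where "\<And>w. w \<in> K \<Longrightarrow> (\<integral>x. norm (f w x) \<partial>N) \<le> B"
proof -
  have "isCont (\<lambda>w. \<integral>x. norm (f w x) \<partial>N) z" if z: "z \<in> U" for z
  proof -
    let ?g = "L1_deriv N f z"
    let ?q = "\<lambda>w x. (f w x - f z x) / (w - z)"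
    have lim: "((\<lambda>w. \<integral>x. norm (?q w x - ?g x) \<partial>N) \<longlongrightarrow> 0) (at z)"
      and ev: "\<forall>\<^sub>F w in at z. integrable N (?q w)"
      using L1_holomorphic_onD(2)[OF f z] by (auto simp: has_L1_derivative_def tendsto_L1_def)
    have intg: "integrable N ?g"
      by (rule L1_holomorphic_onD(3)[OF f z])
    have "\<forall>\<^sub>F w in at z. w \<noteq> z"
      by (simp add: eventually_at_filter)
    moreover have "\<forall>\<^sub>F w in at z. w \<in> U"
      using U z by (rule eventually_at_in_open')
    ultimately have "\<forall>\<^sub>F w in at z. norm ((\<integral>x. norm (f w x) \<partial>N) - (\<integral>x. norm (f z x) \<partial>N))
        \<le> norm (w - z) * ((\<integral>x. norm (?q w x - ?g x) \<partial>N) + (\<integral>x. norm (?g x) \<partial>N))"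
      using ev
    proof eventually_elim
      case (elim w)
      have i: "integrable N (f w)" "integrable N (f z)"
        by (intro L1_holomorphic_onD(1)[OF f] elim z)+
      have iq: "integrable N (\<lambda>x. ?q w x - ?g x)"
        by (intro Bochner_Integration.integrable_diff elim intg)
      have "norm ((\<integral>x. norm (f w x) \<partial>N) - (\<integral>x. norm (f z x) \<partial>N)) = norm (\<integral>x. norm (f w x) - norm (f z x) \<partial>N)"
        using i by simp
      also have "\<dots> \<le> (\<integral>x. norm (norm (f w x) - norm (f z x)) \<partial>N)"
        by (rule integral_norm_bound)
      also have "\<dots> \<le> (\<integral>x. norm (w - z) * (norm (?q w x - ?g x) + norm (?g x)) \<partial>N)"
      proof (rule integral_mono)
        fix x
        have "norm (norm (f w x) - norm (f z x)) \<le> norm (f w x - f z x)"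
          by (simp add: norm_triangle_ineq3)
        also have "\<dots> = norm (w - z) * norm (?q w x)"
          using elim by (simp add: norm_divide)
        also have "norm (?q w x) \<le> norm (?q w x - ?g x) + norm (?g x)"
          using norm_triangle_sub[of "?q w x" "?g x"] by simp
        finally show "norm (norm (f w x) - norm (f z x)) \<le> norm (w - z) * (norm (?q w x - ?g x) + norm (?g x))"
          by (simp add: mult_left_mono)
      qed (use i intg iq in auto)
      also have "\<dots> = norm (w - z) * ((\<integral>x. norm (?q w x - ?g x) \<partial>N) + (\<integral>x. norm (?g x) \<partial>N))"
        using intg iq by simp
      finally show ?case .
    qed
    moreover
    have "((\<lambda>w. norm (w - z) * ((\<integral>x. norm (?q w x - ?g x) \<partial>N) + (\<integral>x. norm (?g x) \<partial>N))) \<longlongrightarrow>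
        norm (z - z) * (0 + (\<integral>x. norm (?g x) \<partial>N))) (at z)"
      by (intro tendsto_intros lim)
    then have "((\<lambda>w. norm (w - z) * ((\<integral>x. norm (?q w x - ?g x) \<partial>N) + (\<integral>x. norm (?g x) \<partial>N))) \<longlongrightarrow> 0) (at z)"
      by simp
    ultimately have "((\<lambda>w. (\<integral>x. norm (f w x) \<partial>N) - (\<integral>x. norm (f z x) \<partial>N)) \<longlongrightarrow> 0) (at z)"
      by (rule Lim_null_comparison)
    then show ?thesis
      unfolding isCont_def by (rule LIM_zero_cancel)
  qed
  then have "continuous_on K (\<lambda>w. \<integral>x. norm (f w x) \<partial>N)"
    using K(2) by (intro continuous_at_imp_continuous_on) auto
  then have "bounded ((\<lambda>w. \<integral>x. norm (f w x) \<partial>N) ` K)"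
    by (intro compact_imp_bounded compact_continuous_image K)
  then obtain B where "\<forall>y\<in>(\<lambda>w. \<integral>x. norm (f w x) \<partial>N) ` K. norm y \<le> B"
    by (auto simp: bounded_iff)
  then show ?thesis
    by (intro that[of B]) (auto intro: order_trans[OF abs_ge_self])
qed

text \<open>This is the first-order Taylor estimate for \<open>deriv \<phi>\<close> at
  \<open>z\<close>, whose remainder involves the third derivative of \<open>\<phi>\<close>. Cauchy's
  inequality on discs of radius \<open>r\<close> around points of \<open>cball z r\<close> bounds
  that by \<open>3! * B / r ^ 3\<close>; such discs reach out to \<open>cball z (2 * r)\<close>.
  Nothing else about \<open>\<phi>\<close> enters the constant.\<close>

lemma deriv_quotient_estimate:
  fixes \<phi> :: "complex \<Rightarrow> complex"
  assumes hol: "\<phi> holomorphic_on V" and V: "open V" "cball z (2 * r) \<subseteq> V" and r: "r > 0"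
    and B: "\<And>w. w \<in> cball z (2 * r) \<Longrightarrow> norm (\<phi> w) \<le> B"
    and w: "w \<in> cball z r" "w \<noteq> z"
  shows "norm ((deriv \<phi> w - deriv \<phi> z) / (w - z) - deriv (deriv \<phi>) z) \<le> 6 * B / r ^ 3 * norm (w - z)"
proof -
  have sub: "cball y r \<subseteq> cball z (2 * r)" if "y \<in> cball z r" for y
  proof
    fix x assume "x \<in> cball y r"
    then show "x \<in> cball z (2 * r)"
      using that dist_triangle[of z x y] by simp
  qed
  have bound: "norm ((deriv ^^ 3) \<phi> y) \<le> 6 * B / r ^ 3" if y: "y \<in> cball z r" for y
  proof -
    have "norm ((deriv ^^ 3) \<phi> y) \<le> fact 3 * B / r ^ 3"
    proof (rule Cauchy_inequality)
      show "\<phi> holomorphic_on ball y r" "continuous_on (cball y r) \<phi>"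
        using order_trans[OF sub[OF y] V(2)] ball_subset_cball[of y r]
        by (blast intro: holomorphic_on_subset[OF hol] holomorphic_on_imp_continuous_on)+
      show "norm (\<phi> x) \<le> B" if "norm (y - x) = r" for x
        using subsetD[OF sub[OF y], of x] that by (intro B) (simp add: dist_norm)
    qed (rule r)
    then show ?thesis
      by (simp add: fact_numeral)
  qed
  \<comment> \<open>The index is shifted by one because \<open>deriv \<phi>\<close> is expanded. The
    remainder is divided by \<open>fact 1\<close>, not \<open>fact 2\<close>, so the constant 6
    survives.\<close>
  let ?f = "\<lambda>i. (deriv ^^ Suc i) \<phi>"
  have "norm (?f 0 w - (\<Sum>i\<le>1. ?f i z * (w - z) ^ i / fact i)) \<le> 6 * B / r ^ 3 * norm (w - z) ^ Suc 1 / fact 1"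
  proof (rule complex_Taylor[where S = "cball z r"])
    show "(?f i has_field_derivative ?f (Suc i) x) (at x within cball z r)" if "x \<in> cball z r" for i x
    proof (rule has_field_derivative_at_within[OF has_field_derivative_higher_deriv[OF hol V(1)]])
      show "x \<in> V"
        using that r by (intro subsetD[OF V(2)]) auto
    qed
    show "norm (?f (Suc 1) x) \<le> 6 * B / r ^ 3" if "x \<in> cball z r" for x
      using bound[OF that] by (simp add: numeral_3_eq_3)
  qed (use w r in auto)
  then have *: "norm (deriv \<phi> w - deriv \<phi> z - deriv (deriv \<phi>) z * (w - z)) \<le> 6 * B / r ^ 3 * (norm (w - z) * norm (w - z))"
    by (simp add: algebra_simps power2_eq_square)
  have "norm ((deriv \<phi> w - deriv \<phi> z) / (w - z) - deriv (deriv \<phi>) z)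
      = norm (deriv \<phi> w - deriv \<phi> z - deriv (deriv \<phi>) z * (w - z)) / norm (w - z)"
    using w(2) by (simp add: norm_divide[symmetric] diff_divide_distrib)
  also have "\<dots> \<le> 6 * B / r ^ 3 * norm (w - z)"
    using * w(2) by (simp add: divide_le_eq mult.assoc)
  finally show ?thesis .
qed

text \<open>An analogue of Goursat's theorem for families in L1: one complex derivative yields the
  next. Difference quotients of the derivative are compared with each other, since there is no
  candidate for their limit yet.\<close>

theorem L1_holomorphic_on_deriv:
  assumes f: "L1_holomorphic_on N f U" and U: "open U"
  shows "L1_holomorphic_on N (L1_deriv N f) U"
  unfolding L1_holomorphic_on_def
proof (intro ballI conjI)
  fix z assume z: "z \<in> U"
  define g where "g = L1_deriv N f"
  have intg: "integrable N (g w)" if "w \<in> U" for w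
    unfolding g_def by (rule L1_holomorphic_onD(3)[OF f that])
  then show "integrable N (L1_deriv N f z)"
    using z by (simp add: g_def)
  obtain s where s: "s > 0" "cball z s \<subseteq> U"
    using U z open_contains_cball by blast
  define r where "r = s / 2"
  have r: "r > 0" "cball z (2 * r) \<subseteq> U"
    using s by (auto simp: r_def)
  have sub: "cball z r \<subseteq> U"
    using r by (intro order_trans[OF _ r(2)] subset_cball) auto
  obtain B where B: "\<And>w. w \<in> cball z (2 * r) \<Longrightarrow> (\<integral>x. norm (f w x) \<partial>N) \<le> B"
    using L1_norm_bounded_on_compact[OF f U compact_cball r(2)] by blast
  define M where "M = 6 * B / r ^ 3"
  define q where "q w x = (g w x - g z x) / (w - z)" for w x
  have intq: "integrable N (q w)" if "w \<in> cball z r" for w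
    unfolding q_def using intg z that sub by (intro integrable_divide Bochner_Integration.integrable_diff) auto
  \<comment> \<open>The difference quotients are Cauchy in \<open>L\<^sub>1\<close>: the Cauchy estimate holds for all pairings with
    a measurable \<open>h\<close>, \<open>|h| \<le> 1\<close>, with the same constant, and a suitable \<open>h\<close> realises the norm.\<close>
  have est: "(\<integral>x. norm (q w x - q w' x) \<partial>N) \<le> M * norm (w - z) + M * norm (w' - z)"
    if w: "w \<in> cball z r" "w \<noteq> z" and w': "w' \<in> cball z r" "w' \<noteq> z" for w w'
  proof -
    have int: "integrable N (\<lambda>x. q w x - q w' x)"
      by (intro Bochner_Integration.integrable_diff intq w w')
    from L1_norm_eq_pairing[OF int] obtain h where h: "h \<in> borel_measurable N" "\<And>x. norm (h x) \<le> 1"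
      and heq: "(\<integral>x. h x * (q w x - q w' x) \<partial>N) = of_real (\<integral>x. norm (q w x - q w' x) \<partial>N)"
      by blast
    define \<phi> where "\<phi> y = (\<integral>x. h x * f y x \<partial>N)" for y
    have der: "(\<phi> has_field_derivative (\<integral>x. h x * g y x \<partial>N)) (at y)" if "y \<in> U" for y
      unfolding \<phi>_def g_def by (rule has_field_derivative_pairing[OF f U that h])
    have hol: "\<phi> holomorphic_on U"
      using der U by (auto simp: holomorphic_on_open)
    have deriv: "deriv \<phi> y = (\<integral>x. h x * g y x \<partial>N)" if "y \<in> U" for y
      using der[OF that] by (rule DERIV_imp_deriv)
    have bnd: "norm (\<phi> y) \<le> B" if "y \<in> cball z (2 * r)" for y
      unfolding \<phi>_def using that r(2)
      by (intro order_trans[OF norm_integral_bounded_mult_le B] h L1_holomorphic_onD(1)[OF f]) auto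
    have quot: "(\<integral>x. h x * q y x \<partial>N) = (deriv \<phi> y - deriv \<phi> z) / (y - z)" if y: "y \<in> cball z r" for y
    proof -
      have yU: "y \<in> U"
        using y sub by auto
      have "(\<integral>x. h x * q y x \<partial>N) = (\<integral>x. (h x * g y x - h x * g z x) / (y - z) \<partial>N)"
        by (rule Bochner_Integration.integral_cong) (auto simp: q_def algebra_simps)
      also have "\<dots> = ((\<integral>x. h x * g y x \<partial>N) - (\<integral>x. h x * g z x \<partial>N)) / (y - z)"
        using integrable_bounded_mult[OF intg[OF yU] h] integrable_bounded_mult[OF intg[OF z] h] by simp
      finally show ?thesis
        by (simp add: deriv yU z)
    qed
    \<comment> \<open>The number \<open>deriv (deriv \<phi>) z\<close> depends on \<open>h\<close>,
      but serves only as an intermediate point of a triangle inequality; \<open>M\<close> does not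
      depend on \<open>h\<close>.\<close>
    have e: "norm ((\<integral>x. h x * q y x \<partial>N) - deriv (deriv \<phi>) z) \<le> M * norm (y - z)"
      if "y \<in> cball z r" "y \<noteq> z" for y
      unfolding quot[OF that(1)] M_def by (rule deriv_quotient_estimate[OF hol U r(2,1) bnd that])
    have "(\<integral>x. norm (q w x - q w' x) \<partial>N) \<le> norm (\<integral>x. h x * (q w x - q w' x) \<partial>N)"
      unfolding heq by simp
    also have "(\<integral>x. h x * (q w x - q w' x) \<partial>N) = (\<integral>x. h x * q w x \<partial>N) - (\<integral>x. h x * q w' x \<partial>N)"
      using integrable_bounded_mult[OF intq[OF w(1)] h] integrable_bounded_mult[OF intq[OF w'(1)] h]
      by (simp add: algebra_simps)
    also have "norm \<dots> \<le> norm ((\<integral>x. h x * q w x \<partial>N) - deriv (deriv \<phi>) z)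
        + norm ((\<integral>x. h x * q w' x \<partial>N) - deriv (deriv \<phi>) z)"
      using norm_triangle_ineq4[of "(\<integral>x. h x * q w x \<partial>N) - deriv (deriv \<phi>) z" "(\<integral>x. h x * q w' x \<partial>N) - deriv (deriv \<phi>) z"]
      by simp
    also have "\<dots> \<le> M * norm (w - z) + M * norm (w' - z)"
      by (intro add_mono e w w')
    finally show ?thesis .
  qed
  \<comment> \<open>Geometric approach to \<open>z\<close> makes the bounds on consecutive
    differences of \<open>q (y n)\<close> summable.\<close>
  define y where "y n = z + of_real (r * (1 / 2) ^ n)" for n :: nat
  have ny: "norm (y n - z) = r * (1 / 2) ^ n" for n
    using r by (simp add: y_def norm_mult norm_power norm_divide)
  have "(1 / 2) ^ n \<le> (1 :: real)" for n
    by (rule power_le_one) auto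
  then have yc: "y n \<in> cball z r" for n
    using ny[of n] r mult_left_le[of "(1 / 2) ^ n" r] by (simp add: dist_norm norm_minus_commute)
  have yz: "y n \<noteq> z" for n
    using r by (simp add: y_def)
  have "summable (\<lambda>n. \<integral>x. norm (q (y (Suc n)) x - q (y n) x) \<partial>N)"
  proof (rule summable_comparison_test')
    show "summable (\<lambda>n. M * (r * (1 / 2) ^ Suc n) + M * (r * (1 / 2) ^ n))"
      by (intro summable_add summable_mult) (simp_all add: summable_geometric summable_mult)
    show "norm (\<integral>x. norm (q (y (Suc n)) x - q (y n) x) \<partial>N) \<le> M * (r * (1 / 2) ^ Suc n) + M * (r * (1 / 2) ^ n)" for n
      using est[OF yc yz yc yz, of "Suc n" n] unfolding ny by simp
  qed
  from tendsto_L1_summable_increments[OF intq[OF yc] this]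
  obtain k where k: "tendsto_L1 N (\<lambda>n. q (y n)) k sequentially"
    by blast
  have intk: "integrable N k" and limk: "(\<lambda>n. \<integral>x. norm (q (y n) x - k x) \<partial>N) \<longlonglongrightarrow> 0"
    using k by (auto simp: tendsto_L1_def)
  \<comment> \<open>Sending \<open>n\<close> to infinity in the comparison of \<open>q w\<close>
    with \<open>q (y n)\<close> turns the limit along one sequence into a rate for every
    \<open>w\<close> near \<open>z\<close>.\<close>
  have estk: "(\<integral>x. norm (q w x - k x) \<partial>N) \<le> M * norm (w - z)" if w: "w \<in> cball z r" "w \<noteq> z" for w
  proof (rule LIMSEQ_le_const)
    have "(\<lambda>n. M * norm (w - z) + M * (r * (1 / 2) ^ n) + (\<integral>x. norm (q (y n) x - k x) \<partial>N))
        \<longlonglongrightarrow> M * norm (w - z) + M * (r * 0) + 0"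
      by (intro tendsto_intros limk LIMSEQ_power_zero) auto
    then show "(\<lambda>n. M * norm (w - z) + M * (r * (1 / 2) ^ n) + (\<integral>x. norm (q (y n) x - k x) \<partial>N))
        \<longlonglongrightarrow> M * norm (w - z)"
      by simp
    have "(\<integral>x. norm (q w x - k x) \<partial>N)
        \<le> M * norm (w - z) + M * (r * (1 / 2) ^ n) + (\<integral>x. norm (q (y n) x - k x) \<partial>N)" for n
    proof -
      have i: "integrable N (\<lambda>x. norm (q w x - q (y n) x))" "integrable N (\<lambda>x. norm (q (y n) x - k x))"
        "integrable N (\<lambda>x. norm (q w x - k x))"
        by (intro integrable_norm Bochner_Integration.integrable_diff intq intk w yc)+
      have "(\<integral>x. norm (q w x - k x) \<partial>N) \<le> (\<integral>x. norm (q w x - q (y n) x) + norm (q (y n) x - k x) \<partial>N)"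
        using i by (intro integral_mono Bochner_Integration.integrable_add norm_diff_triangle_ineq)
          (auto intro: norm_triangle_le_diff norm_diff_triangle_le)
      also have "\<dots> = (\<integral>x. norm (q w x - q (y n) x) \<partial>N) + (\<integral>x. norm (q (y n) x - k x) \<partial>N)"
        using i by simp
      also have "\<dots> \<le> M * norm (w - z) + M * (r * (1 / 2) ^ n) + (\<integral>x. norm (q (y n) x - k x) \<partial>N)"
        using est[OF w yc yz, of n] unfolding ny by simp
      finally show ?thesis .
    qed
    then show "\<exists>n0. \<forall>n\<ge>n0. (\<integral>x. norm (q w x - k x) \<partial>N)
        \<le> M * norm (w - z) + M * (r * (1 / 2) ^ n) + (\<integral>x. norm (q (y n) x - k x) \<partial>N)"
      by blast
  qed
  have "\<forall>\<^sub>F w in at z. w \<in> ball z r"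
    using r by (intro eventually_at_in_open') auto
  moreover have "\<forall>\<^sub>F w in at z. w \<noteq> z"
    by (simp add: eventually_at_filter)
  ultimately have ev: "\<forall>\<^sub>F w in at z. w \<in> cball z r \<and> w \<noteq> z"
    by eventually_elim auto
  have "((\<lambda>w. M * norm (w - z)) \<longlongrightarrow> M * norm (z - z)) (at z)"
    by (intro tendsto_intros)
  then have "((\<lambda>w. M * norm (w - z)) \<longlongrightarrow> 0) (at z)"
    by simp
  then have "((\<lambda>w. \<integral>x. norm (q w x - k x) \<partial>N) \<longlongrightarrow> 0) (at z)"
    by (rule Lim_null_comparison[rotated]) (use ev estk in \<open>auto elim!: eventually_mono\<close>)
  moreover have "\<forall>\<^sub>F w in at z. integrable N (q w)"
    using ev by eventually_elim (auto intro: intq)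
  ultimately have "has_L1_derivative N g k z"
    using intk by (simp add: has_L1_derivative_def tendsto_L1_def q_def[abs_def])
  then show "\<exists>k. has_L1_derivative N (L1_deriv N f) k z"
    by (auto simp: g_def)
qed

corollary L1_holomorphic_on_higher_deriv:
  assumes "L1_holomorphic_on N f U" "open U"
  shows "L1_holomorphic_on N ((L1_deriv N ^^ n) f) U"
  by (induction n) (use assms in \<open>auto intro: L1_holomorphic_on_deriv\<close>)

section \<open>Derivatives of integrals in the parameter\<close>

lemma has_field_derivative_integral:
  assumes "L1_holomorphic_on N f U" "open U" "z \<in> U"
  shows "((\<lambda>z. \<integral>x. f z x \<partial>N) has_field_derivative (\<integral>x. L1_deriv N f z x \<partial>N)) (at z)"
  using has_field_derivative_pairing[OF assms, of "\<lambda>_. 1"] by simp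

lemma holomorphic_on_integral:
  assumes "L1_holomorphic_on N f U" "open U"
  shows "(\<lambda>z. \<integral>x. f z x \<partial>N) holomorphic_on U"
  using has_field_derivative_integral[OF assms] assms(2) by (auto simp: holomorphic_on_open)

text \<open>The induction hypothesis holds throughout the open set \<open>U\<close>, so both
  functions agree near \<open>z\<close> and have the same derivative there. In particular the
  integrals do not depend on the representatives chosen by \<open>L1_deriv\<close>.\<close>

lemma higher_deriv_integral:
  assumes f: "L1_holomorphic_on N f U" and U: "open U" and z: "z \<in> U"
  shows "(deriv ^^ n) (\<lambda>z. \<integral>x. f z x \<partial>N) z = (\<integral>x. (L1_deriv N ^^ n) f z x \<partial>N)"
  using z
proof (induction n arbitrary: z)
  case (Suc n)
  have "(deriv ^^ Suc n) (\<lambda>z. \<integral>x. f z x \<partial>N) z = deriv (\<lambda>z. \<integral>x. (L1_deriv N ^^ n) f z x \<partial>N) z"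
    using Suc U by (auto intro!: deriv_cong_ev elim!: eventually_mono[OF eventually_nhds_in_open])
  also have "\<dots> = (\<integral>x. (L1_deriv N ^^ Suc n) f z x \<partial>N)"
    using has_field_derivative_integral[OF L1_holomorphic_on_higher_deriv[OF f U] U Suc.prems, of n]
    by (simp add: DERIV_imp_deriv)
  finally show ?case .
qed simp

lemma has_L1_derivative_cong:
  assumes "open U" "z \<in> U" "\<And>w. w \<in> U \<Longrightarrow> f w = f' w"
  shows "has_L1_derivative N f g z \<longleftrightarrow> has_L1_derivative N f' g z"
proof -
  have ev: "\<forall>\<^sub>F w in at z. f w = f' w"
    using eventually_at_in_open'[OF assms(1,2)] by eventually_elim (rule assms(3))
  have "f z = f' z"
    by (rule assms(3)[OF assms(2)])
  then show ?thesis
    unfolding has_L1_derivative_def tendsto_L1_def using ev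
    by (intro conj_cong refl eventually_subst filterlim_cong) (auto elim!: eventually_mono)
qed

lemma higher_L1_deriv_cong:
  assumes U: "open U" and eq: "\<And>w. w \<in> U \<Longrightarrow> f w = f' w" and z: "z \<in> U"
  shows "(L1_deriv N ^^ n) f z = (L1_deriv N ^^ n) f' z"
  using z
proof (induction n arbitrary: z)
  case (Suc n)
  show ?case
    using has_L1_derivative_cong[OF U Suc.prems Suc.IH] by (simp add: L1_deriv_def)
qed (simp add: eq)

section \<open>Series of holomorphic functions\<close>

text \<open>The maximum principle is applied to the differences \<open>S i - S j\<close>, since
  \<open>g\<close> is a limit on the sphere only. This makes the net uniformly Cauchy on the closed
  disc, and completeness of the complex numbers yields \<open>G\<close>. A general filter is needed
  for unconditional sums.\<close>

lemma uniform_limit_cball_from_sphere: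
  fixes S :: "'i \<Rightarrow> complex \<Rightarrow> complex"
  assumes F: "F \<noteq> bot"
    and S: "\<forall>\<^sub>F i in F. continuous_on (cball z r) (S i) \<and> S i holomorphic_on ball z r"
    and lim: "uniform_limit (sphere z r) S g F"
  obtains G where "uniform_limit (cball z r) S G F"
proof -
  have cauchy: "\<exists>P. eventually P F \<and> (\<forall>i j. P i \<and> P j \<longrightarrow> (\<forall>w\<in>cball z r. dist (S i w) (S j w) \<le> e))"
    if e: "e > 0" for e
  proof (intro exI conjI allI impI ballI)
    let ?P = "\<lambda>i. (continuous_on (cball z r) (S i) \<and> S i holomorphic_on ball z r) \<and>
        (\<forall>w\<in>sphere z r. dist (S i w) (g w) < e / 2)"
    show "eventually ?P F"
      using e by (intro eventually_conj S uniform_limitD[OF lim]) auto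
    fix i j w assume P: "?P i \<and> ?P j" and w: "w \<in> cball z r"
    have "norm (S i w - S j w) \<le> e"
    proof (rule maximum_modulus_frontier[where f = "\<lambda>w. S i w - S j w" and S = "cball z r"])
      show "norm (S i x - S j x) \<le> e" if "x \<in> frontier (cball z r)" for x
      proof -
        have "dist (S i x) (g x) < e / 2" "dist (S j x) (g x) < e / 2"
          using that P by auto
        then show ?thesis
          using dist_triangle2[of "S i x" "S j x" "g x"] by (simp add: dist_norm)
      qed
    qed (use P w in \<open>auto intro!: holomorphic_intros continuous_intros\<close>)
    then show "dist (S i w) (S j w) \<le> e"
      by (simp add: dist_norm)
  qed
  have "\<exists>l. ((\<lambda>i. S i w) \<longlongrightarrow> l) F" if w: "w \<in> cball z r" for w
  proof -
    have "cauchy_filter (filtermap (\<lambda>i. S i w) F)"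
      unfolding cauchy_filter_metric_filtermap
    proof (intro allI impI)
      fix e :: real assume "e > 0"
      then show "\<exists>P. eventually P F \<and> (\<forall>i j. P i \<and> P j \<longrightarrow> dist (S i w) (S j w) < e)"
        using cauchy[of "e / 2"] w by fastforce
    qed
    from cauchy_filter_complete_converges[OF this complete_UNIV] show ?thesis
      using F by (simp add: filterlim_def filtermap_bot_iff)
  qed
  then obtain G where G: "\<And>w. w \<in> cball z r \<Longrightarrow> ((\<lambda>i. S i w) \<longlongrightarrow> G w) F"
    by metis
  have "uniform_limit (cball z r) S G F"
    unfolding uniform_limit_iff
  proof (intro allI impI)
    fix e :: real assume e: "e > 0"
    then obtain P where P: "eventually P F"
      "\<And>i j w. P i \<Longrightarrow> P j \<Longrightarrow> w \<in> cball z r \<Longrightarrow> dist (S i w) (S j w) \<le> e / 2"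
      using cauchy[of "e / 2"] by (metis half_gt_zero)
    show "\<forall>\<^sub>F i in F. \<forall>w\<in>cball z r. dist (S i w) (G w) < e"
      using P(1)
    proof eventually_elim
      case (elim i)
      show ?case
      proof
        fix w assume w: "w \<in> cball z r"
        \<comment> \<open>The limit in \<open>j\<close> keeps only a non-strict bound;
          \<open>e / 2\<close> leaves room for the strict one.\<close>
        have "dist (S i w) (G w) \<le> e / 2"
        proof (rule tendsto_upperbound[OF _ _ F])
          show "((\<lambda>j. dist (S i w) (S j w)) \<longlongrightarrow> dist (S i w) (G w)) F"
            by (intro tendsto_intros G w)
          show "\<forall>\<^sub>F j in F. dist (S i w) (S j w) \<le> e / 2"
            using P(1) by eventually_elim (rule P(2)[OF elim _ w])
        qed
        then show "dist (S i w) (G w) < e"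
          using e by simp
      qed
    qed
  qed
  then show ?thesis
    by (rule that)
qed

lemma higher_deriv_sum:
  assumes "finite F" "\<And>i. i \<in> F \<Longrightarrow> f i holomorphic_on S" "open S" "z \<in> S"
  shows "(deriv ^^ n) (\<lambda>w. \<Sum>i\<in>F. f i w) z = (\<Sum>i\<in>F. (deriv ^^ n) (f i) z)"
  using assms
proof (induction F rule: finite_induct)
  case (insert i F)
  have "(deriv ^^ n) (\<lambda>w. f i w + (\<Sum>i\<in>F. f i w)) z
      = (deriv ^^ n) (f i) z + (deriv ^^ n) (\<lambda>w. \<Sum>i\<in>F. f i w) z"
    using insert.prems by (intro higher_deriv_add[of _ S] holomorphic_on_sum) auto
  then show ?case
    using insert by simp
qed simp

text \<open>Uniqueness of limits identifies the limit on the disc with the infinite sum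
  \<open>G\<close>. Weierstrass' theorem along the net of finite subsets then permits termwise
  differentiation at the centre.\<close>

lemma holomorphic_series_from_sphere:
  fixes f :: "'i \<Rightarrow> complex \<Rightarrow> complex"
  assumes hol: "\<And>\<iota>. \<iota> \<in> J \<Longrightarrow> f \<iota> holomorphic_on U" and U: "cball z r \<subseteq> U" and r: "r > 0"
    and lim: "uniform_limit (sphere z r) (\<lambda>F w. \<Sum>\<iota>\<in>F. f \<iota> w) g (finite_subsets_at_top J)"
  defines "G \<equiv> \<lambda>w. \<Sum>\<^sub>\<infinity>\<iota>\<in>J. f \<iota> w"
  shows "\<And>w. w \<in> cball z r \<Longrightarrow> ((\<lambda>\<iota>. f \<iota> w) has_sum G w) J"
    and "G holomorphic_on ball z r"
    and "((\<lambda>\<iota>. (deriv ^^ n) (f \<iota>) z) has_sum (deriv ^^ n) G z) J"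
proof -
  let ?F = "finite_subsets_at_top J"
  let ?S = "\<lambda>F w. \<Sum>\<iota>\<in>F. f \<iota> w"
  have evJ: "\<forall>\<^sub>F F in ?F. finite F \<and> F \<subseteq> J"
    by (rule eventually_finite_subsets_at_top_weakI) auto
  have ballU: "ball z r \<subseteq> U"
    using ball_subset_cball U by (rule order_trans)
  have ev: "\<forall>\<^sub>F F in ?F. continuous_on (cball z r) (?S F) \<and> ?S F holomorphic_on ball z r"
    using evJ
  proof eventually_elim
    case (elim F)
    then have "?S F holomorphic_on U"
      by (intro holomorphic_intros hol) auto
    then show ?case
      using U ballU by (meson holomorphic_on_imp_continuous_on holomorphic_on_subset)
  qed
  obtain G' where G': "uniform_limit (cball z r) ?S G' ?F"
    using uniform_limit_cball_from_sphere[OF finite_subsets_at_top_neq_bot ev lim] .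
  have sum: "((\<lambda>\<iota>. f \<iota> w) has_sum G' w) J" if "w \<in> cball z r" for w
    unfolding has_sum_def using tendsto_uniform_limitI[OF G' that] .
  have eq: "G' w = G w" if "w \<in> cball z r" for w
    unfolding G_def using infsumI[OF sum[OF that]] by simp
  show "((\<lambda>\<iota>. f \<iota> w) has_sum G w) J" if "w \<in> cball z r" for w
    using sum[OF that] eq[OF that] by simp
  have ul: "uniform_limit (cball z r) ?S G ?F"
    using G' uniform_limit_cong'[of "cball z r" ?S ?S G' G ?F] eq by simp
  show "G holomorphic_on ball z r"
    by (rule holomorphic_uniform_limit[OF ev ul finite_subsets_at_top_neq_bot])
  have "((\<lambda>F. (deriv ^^ n) (?S F) z) \<longlongrightarrow> (deriv ^^ n) G z) ?F"
  proof (rule higher_deriv_complex_uniform_limit)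
    show "uniform_limit (ball z r) ?S G ?F"
      by (rule uniform_limit_on_subset[OF ul]) auto
    show "\<forall>\<^sub>F F in ?F. ?S F holomorphic_on ball z r"
      using ev by eventually_elim auto
  qed (use r in auto)
  moreover have "\<forall>\<^sub>F F in ?F. (deriv ^^ n) (?S F) z = (\<Sum>\<iota>\<in>F. (deriv ^^ n) (f \<iota>) z)"
    using evJ
  proof eventually_elim
    case (elim F)
    then show ?case
      using ballU r by (intro higher_deriv_sum[of _ _ "ball z r"]) (auto intro: holomorphic_on_subset[OF hol])
  qed
  ultimately show "((\<lambda>\<iota>. (deriv ^^ n) (f \<iota>) z) has_sum (deriv ^^ n) G z) J"
    unfolding has_sum_def by (rule Lim_transform_eventually)
qed

text \<open>The numerator \<open>fact l\<close> absorbs the factors \<open>l + 1\<close>, ...,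
  \<open>l + j\<close> that differentiation produces, so every derivative has the same
  shape.\<close>

lemma higher_deriv_inverse_power:
  fixes c z :: complex
  assumes "c + z \<noteq> 0"
  shows "(deriv ^^ j) (\<lambda>z. fact l / (c + z) ^ (l + 1)) z = (-1) ^ j * fact (l + j) / (c + z) ^ (l + j + 1)"
  using assms
proof (induction j arbitrary: z)
  case (Suc j)
  have op: "open {z. c + z \<noteq> 0}"
    by (intro open_Collect_neq continuous_intros)
  have "(deriv ^^ Suc j) (\<lambda>z. fact l / (c + z) ^ (l + 1)) z
      = deriv (\<lambda>z. (-1) ^ j * fact (l + j) / (c + z) ^ (l + j + 1)) z"
    using Suc eventually_nhds_in_open[OF op, of z]
    by (auto intro!: deriv_cong_ev elim!: eventually_mono)
  also have "\<dots> = (-1) ^ Suc j * fact (l + Suc j) / (c + z) ^ (l + Suc j + 1)"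
  proof (rule DERIV_imp_deriv)
    define K :: complex where "K = (-1) ^ j * fact (l + j)"
    define p where "p = (c + z) ^ (l + j)"
    have nz: "c + z \<noteq> 0" "p \<noteq> 0"
      using Suc.prems by (auto simp: p_def)
    have "((\<lambda>z. (c + z) ^ Suc (l + j)) has_field_derivative of_nat (Suc (l + j)) * p) (at z)"
      by (rule derivative_eq_intros refl)+ (simp add: p_def)
    from DERIV_inverse_fun[OF this]
    have "((\<lambda>z. inverse ((c + z) ^ Suc (l + j))) has_field_derivative
        - (inverse ((c + z) * p) * (of_nat (Suc (l + j)) * p) * inverse ((c + z) * p))) (at z)"
      using nz by (simp add: p_def mult_ac)
    from DERIV_cmult[OF this, of K]
    have "((\<lambda>z. K / (c + z) ^ Suc (l + j)) has_field_derivative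
        K * - (inverse ((c + z) * p) * (of_nat (Suc (l + j)) * p) * inverse ((c + z) * p))) (at z)"
      by (simp add: divide_inverse)
    also have "K * - (inverse ((c + z) * p) * (of_nat (Suc (l + j)) * p) * inverse ((c + z) * p))
        = - K * of_nat (Suc (l + j)) / ((c + z) * ((c + z) * p))"
      using nz by (simp add: divide_simps del: of_nat_Suc)
    also have "\<dots> = (-1) ^ Suc j * fact (l + Suc j) / (c + z) ^ (l + Suc j + 1)"
      by (simp add: K_def p_def mult_ac)
    finally show "((\<lambda>z. (-1) ^ j * fact (l + j) / (c + z) ^ (l + j + 1)) has_field_derivative
        (-1) ^ Suc j * fact (l + Suc j) / (c + z) ^ (l + Suc j + 1)) (at z)"
      by (simp add: K_def)
  qed
  finally show ?case .
qed simp

text \<open>Division by \<open>z ^ m\<close> sends the first \<open>m\<close> terms to the principal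
  part and leaves a power series with shifted coefficients. For a critical index, \<open>m\<close>
  is the pole order bound \<open>l \<iota> + 1\<close>.\<close>

lemma laurent_tail_sums:
  fixes z :: complex
  assumes z: "z \<noteq> 0" and s: "(\<lambda>n. a n * z ^ n) sums s"
  shows "(\<lambda>n. a (n + m) * z ^ n) sums (s / z ^ m - (\<Sum>n<m. a n / z ^ (m - n)))"
proof -
  have "(\<lambda>n. a (n + m) * z ^ (n + m)) sums (s - (\<Sum>n<m. a n * z ^ n))"
    by (rule sums_split_initial_segment[OF s])
  from sums_divide[OF this, of "z ^ m"]
  have "(\<lambda>n. a (n + m) * z ^ n) sums (s / z ^ m - (\<Sum>n<m. a n * z ^ n) / z ^ m)"
    using z by (simp add: power_add diff_divide_distrib)
  moreover have "(\<Sum>n<m. a n * z ^ n) / z ^ m = (\<Sum>n<m. a n / z ^ (m - n))"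
    unfolding sum_divide_distrib using z
    by (intro sum.cong) (auto simp: power_diff)
  ultimately show ?thesis
    by simp
qed

section \<open>The Laurent expansion at zero\<close>

text \<open>A counting argument: each index with \<open>d \<iota>\<close> in the disc contributes at
  least \<open>e\<close> to a convergent sum of nonnegative terms, so there are at most
  \<open>infsum / e\<close> of them.\<close>

lemma finite_norm_le_if_inverse_square_summable:
  fixes d :: "'i \<Rightarrow> complex"
  assumes sm: "(\<lambda>\<iota>. (norm (inverse (d \<iota> - \<delta>)))\<^sup>2) summable_on I" and \<delta>: "\<delta> \<notin> d ` I"
  shows "finite {\<iota>\<in>I. norm (d \<iota> - c) \<le> R}"
proof -
  define S where "S = {\<iota>\<in>I. norm (d \<iota> - c) \<le> R}"
  \<comment> \<open>The summand 1 keeps the denominator positive, and the absolute value admits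
    negative \<open>R\<close>.\<close>
  define e where "e = (1 / (1 + \<bar>R\<bar> + norm (c - \<delta>)))\<^sup>2"
  have pos: "1 + \<bar>R\<bar> + norm (c - \<delta>) > 0"
    by (intro add_pos_nonneg) auto
  have e: "e > 0"
    using pos unfolding e_def by (intro zero_less_power divide_pos_pos) auto
  let ?f = "\<lambda>\<iota>. (norm (inverse (d \<iota> - \<delta>)))\<^sup>2"
  have le: "e \<le> ?f \<iota>" if "\<iota> \<in> S" for \<iota>
  proof -
    have "norm (d \<iota> - \<delta>) \<le> norm (d \<iota> - c) + norm (c - \<delta>)"
      using norm_triangle_ineq[of "d \<iota> - c" "c - \<delta>"] by simp
    then have *: "norm (d \<iota> - \<delta>) \<le> 1 + \<bar>R\<bar> + norm (c - \<delta>)"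
      using that unfolding S_def by simp linarith
    have "d \<iota> \<noteq> \<delta>"
      using that \<delta> by (auto simp: S_def)
    then have "1 / (1 + \<bar>R\<bar> + norm (c - \<delta>)) \<le> 1 / norm (d \<iota> - \<delta>)"
      using * by (intro divide_left_mono mult_pos_pos pos) auto
    then show ?thesis
      unfolding e_def using pos by (intro power_mono) (auto simp: norm_inverse divide_inverse)
  qed
  have "card G \<le> nat \<lceil>infsum ?f I / e\<rceil>" if G: "G \<subseteq> S" "finite G" for G
  proof -
    have "real (card G) * e = (\<Sum>\<iota>\<in>G. e)"
      by simp
    also have "\<dots> \<le> sum ?f G"
      using G by (intro sum_mono le) auto
    also have "\<dots> \<le> infsum ?f I"
      using G by (intro finite_sum_le_infsum sm) (auto simp: S_def)
    finally have "real (card G) \<le> infsum ?f I / e"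
      using e by (simp add: field_simps)
    then show ?thesis
      by linarith
  qed
  from finite_if_finite_subsets_card_bdd[OF this] show ?thesis
    by (simp add: S_def)
qed

text \<open>Leibniz' rule for the numerator \<open>A\<close> and the pole factor, whose derivatives
  at 0 are explicit. The binomial coefficients arise here.\<close>

lemma higher_deriv_log_homogeneous_term:
  fixes A :: "complex \<Rightarrow> complex"
  assumes A: "A holomorphic_on V" and V: "open V" "0 \<in> V" and c: "c \<noteq> 0"
  shows "(deriv ^^ n) (\<lambda>z. (-1) ^ (l + 1) * fact l * A z / (c + z) ^ (l + 1)) 0 / fact n
    = (\<Sum>j=0..n. of_nat (n choose j) *
        ((-1) ^ (l + j + 1) * fact (l + j) * (deriv ^^ (n - j)) A 0 / (fact n * c ^ (l + j + 1))))"
proof -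
  \<comment> \<open>The pole at \<open>- c\<close> is cut out; \<open>c \<noteq> 0\<close> keeps 0
    inside.\<close>
  let ?V = "V \<inter> {z. c + z \<noteq> 0}"
  have V': "open ?V" "0 \<in> ?V"
    using V c by (auto intro!: open_Int open_Collect_neq continuous_intros)
  let ?p = "\<lambda>z. fact l / (c + z) ^ (l + 1)"
  have A': "A holomorphic_on ?V"
    by (rule holomorphic_on_subset[OF A]) auto
  have p: "?p holomorphic_on ?V"
    by (intro holomorphic_intros) auto
  have "(deriv ^^ n) (\<lambda>z. (-1) ^ (l + 1) * fact l * A z / (c + z) ^ (l + 1)) 0
      = (deriv ^^ n) (\<lambda>z. (-1) ^ (l + 1) * (?p z * A z)) 0"
    by (simp add: mult_ac)
  also have "\<dots> = (-1) ^ (l + 1) * (deriv ^^ n) (\<lambda>z. ?p z * A z) 0"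
    by (rule higher_deriv_cmult[OF holomorphic_on_mult[OF p A'] V'(2,1)])
  also have "(deriv ^^ n) (\<lambda>z. ?p z * A z) 0
      = (\<Sum>j=0..n. of_nat (n choose j) * (deriv ^^ j) ?p 0 * (deriv ^^ (n - j)) A 0)"
    by (rule higher_deriv_mult[OF p A' V'])
  also have "\<dots> = (\<Sum>j=0..n. of_nat (n choose j) * ((-1) ^ j * fact (l + j) / c ^ (l + j + 1)) * (deriv ^^ (n - j)) A 0)"
    using c by (intro sum.cong refl) (subst higher_deriv_inverse_power, auto)
  finally show ?thesis
    by (simp add: sum_distrib_left sum_divide_distrib power_add mult_ac)
qed

lemma filterlim_union_finite_subsets_at_top:
  assumes "finite J" "J \<subseteq> I"
  shows "filterlim (\<lambda>F. F \<union> J) (finite_subsets_at_top I) (finite_subsets_at_top (I - J))"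
  unfolding filterlim_iff
proof (intro allI impI)
  fix P assume "eventually P (finite_subsets_at_top I)"
  then obtain X where X: "finite X" "X \<subseteq> I" and P: "\<forall>Y. finite Y \<and> X \<subseteq> Y \<and> Y \<subseteq> I \<longrightarrow> P Y"
    unfolding eventually_finite_subsets_at_top by (elim exE conjE)
  have "P (Y \<union> J)" if "finite Y" "X - J \<subseteq> Y" "Y \<subseteq> I - J" for Y
    using that assms X(2) by (intro P[rule_format]) auto
  then show "\<forall>\<^sub>F F in finite_subsets_at_top (I - J). P (F \<union> J)"
    unfolding eventually_finite_subsets_at_top using X
    by (intro exI[of _ "X - J"]) (simp add: Diff_mono)
qed

text \<open>Finite subsets of \<open>I - J\<close>, enlarged by \<open>J\<close>, are cofinal enough
  to inherit the limit over \<open>I\<close>; the fixed finite sum is then subtracted. This discards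
  the critical terms, whose poles lie at the centre of the circle.\<close>

lemma uniform_limit_sum_remove_finite:
  fixes f :: "'i \<Rightarrow> 'a \<Rightarrow> 'b::real_normed_vector"
  assumes lim: "uniform_limit K (\<lambda>F w. \<Sum>\<iota>\<in>F. f \<iota> w) g (finite_subsets_at_top I)"
    and J: "finite J" "J \<subseteq> I"
  shows "uniform_limit K (\<lambda>F w. \<Sum>\<iota>\<in>F. f \<iota> w) (\<lambda>w. g w - (\<Sum>\<iota>\<in>J. f \<iota> w)) (finite_subsets_at_top (I - J))"
proof -
  have "uniform_limit K (\<lambda>F w. \<Sum>\<iota>\<in>F \<union> J. f \<iota> w) g (finite_subsets_at_top (I - J))"
    by (rule filterlim_compose[OF lim filterlim_union_finite_subsets_at_top[OF J]])
  then have diff: "uniform_limit K (\<lambda>F w. (\<Sum>\<iota>\<in>F \<union> J. f \<iota> w) - (\<Sum>\<iota>\<in>J. f \<iota> w)) (\<lambda>w. g w - (\<Sum>\<iota>\<in>J. f \<iota> w))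
      (finite_subsets_at_top (I - J))"
    by (intro uniform_limit_intros)
  have "\<forall>\<^sub>F F in finite_subsets_at_top (I - J). \<forall>w\<in>K.
      (\<Sum>\<iota>\<in>F \<union> J. f \<iota> w) - (\<Sum>\<iota>\<in>J. f \<iota> w) = (\<Sum>\<iota>\<in>F. f \<iota> w)"
  proof (rule eventually_finite_subsets_at_top_weakI)
    fix F assume "finite F" "F \<subseteq> I - J"
    then have "F \<inter> J = {}"
      by auto
    with \<open>finite F\<close> show "\<forall>w\<in>K. (\<Sum>\<iota>\<in>F \<union> J. f \<iota> w) - (\<Sum>\<iota>\<in>J. f \<iota> w) = (\<Sum>\<iota>\<in>F. f \<iota> w)"
      using J(1) by (simp add: sum.union_disjoint)
  qed
  from uniform_limit_cong[OF this refl] diff show ?thesis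
    by blast
qed

section \<open>Location of the poles and assembly of the expansion\<close>

context gauged_poly_log_homogeneous
begin

lemma finite_critical_indices: "finite (critical_indices D I d)"
  unfolding critical_indices_def by (rule degrees_finite)

text \<open>Only finitely many degrees lie within distance 1 of \<open>- of_nat D - 1\<close>, so
  those different from it keep a positive distance; all others are at distance at least 1. This
  explains \<open>min \<rho> 1\<close>.\<close>

lemma noncritical_poles_bounded_away:
  obtains \<rho> where "\<rho> > 0" "\<And>\<iota>. \<iota> \<in> I - critical_indices D I d \<Longrightarrow> \<rho> \<le> norm (of_nat D + d \<iota> + 1)"
proof -
  \<comment> \<open>The square summability is assumed only for a base point that is not a degree.
    One exists because the degrees, indexed by naturals, are countable.\<close>
  have "uncountable (UNIV - d ` I)"
    using uncountable_UNIV_complex by (intro uncountable_minus_countable) auto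
  then obtain \<delta> where \<delta>: "\<delta> \<notin> d ` I"
    by (metis DiffD2 all_not_in_conv countable_empty)
  let ?c = "- of_nat D - 1 :: complex"
  let ?S = "{\<iota>\<in>I. norm (d \<iota> - ?c) \<le> 1}"
  have "finite (d ` ?S)"
    by (intro finite_imageI finite_norm_le_if_inverse_square_summable[OF degrees_l2[OF \<delta>] \<delta>])
  from finite_set_avoid[OF this, of ?c]
  obtain \<rho> where \<rho>: "\<rho> > 0" "\<And>x. x \<in> d ` ?S \<Longrightarrow> x \<noteq> ?c \<Longrightarrow> \<rho> \<le> dist ?c x"
    by blast
  show ?thesis
  proof (rule that[of "min \<rho> 1"])
    fix \<iota> assume \<iota>: "\<iota> \<in> I - critical_indices D I d"
    have eq: "norm (of_nat D + d \<iota> + 1) = norm (d \<iota> - ?c)"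
      by (simp add: algebra_simps)
    show "min \<rho> 1 \<le> norm (of_nat D + d \<iota> + 1)"
    proof (cases "\<iota> \<in> ?S")
      case True
      then have "\<rho> \<le> dist ?c (d \<iota>)"
        using \<iota> by (intro \<rho>(2)) (auto simp: critical_indices_def)
      then show ?thesis
        unfolding eq by (simp add: dist_norm norm_minus_commute)
    next
      case False
      then have "1 \<le> norm (d \<iota> - ?c)"
        using \<iota> by auto
      then show ?thesis
        unfolding eq by simp
    qed
  qed (use \<rho> in auto)
qed

theorem zeta_laurent_expansion:
  assumes conv: "zeta_series_converges D vol U I d l \<alpha>t"
  defines "I0 \<equiv> critical_indices D I d"
    and "a \<equiv> \<lambda>n. (\<integral>x. (L1_deriv (cone_measure D vol) ^^ n) \<alpha>0 0 x \<partial>cone_measure D vol) / fact n"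
    and "b \<equiv> \<lambda>n \<iota>. \<Sum>j=0..n. of_nat (n choose j) *
            ((-1) ^ (l \<iota> + j + 1) * fact (l \<iota> + j) *
               (\<integral>\<nu>. (L1_deriv vol ^^ (n - j)) (\<alpha>t \<iota>) 0 \<nu> \<partial>vol)
             / (fact n * (of_nat D + d \<iota> + 1) ^ (l \<iota> + j + 1)))"
    and "c \<equiv> \<lambda>n. \<Sum>\<iota>\<in>critical_indices D I d. (-1) ^ (l \<iota> + 1) * fact (l \<iota>) *
            (\<integral>\<nu>. (L1_deriv vol ^^ (n + l \<iota> + 1)) (\<alpha>t \<iota>) 0 \<nu> \<partial>vol) / fact (n + l \<iota> + 1)"
  shows "\<And>n. b n summable_on (I - I0)"
    and "\<exists>\<epsilon>>0. \<forall>z. norm z < \<epsilon> \<and> (z \<noteq> 0 \<or> I0 = {}) \<longrightarrow>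
        summable (\<lambda>n. a n * z ^ n) \<and>
        summable (\<lambda>n. (\<Sum>\<^sub>\<infinity>\<iota>\<in>I - I0. b n \<iota>) * z ^ n) \<and>
        summable (\<lambda>n. c n * z ^ n) \<and>
        zeta D vol \<alpha>0 I d l \<alpha>t z =
          (\<Sum>\<iota>\<in>I0. \<Sum>n=0..l \<iota>. (-1) ^ (l \<iota> + 1) * fact (l \<iota>) *
              (\<integral>\<nu>. (L1_deriv vol ^^ n) (\<alpha>t \<iota>) 0 \<nu> \<partial>vol) / (fact n * z ^ (l \<iota> + 1 - n)))
          + (\<Sum>n. a n * z ^ n)
          + (\<Sum>n. (\<Sum>\<^sub>\<infinity>\<iota>\<in>I - I0. b n \<iota>) * z ^ n)
          + (\<Sum>n. c n * z ^ n)"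
proof -
  let ?R = "\<lambda>\<iota> z. residue_term D vol d l \<alpha>t \<iota> z"
  define A where "A \<iota> z = (\<integral>\<nu>. \<alpha>t \<iota> z \<nu> \<partial>vol)" for \<iota> z
  define H where "H z = (\<integral>x. \<alpha>0 z x \<partial>cone_measure D vol)" for z
  define G where "G z = (\<Sum>\<^sub>\<infinity>\<iota>\<in>I - I0. ?R \<iota> z)" for z
  have zero: "0 \<in> U"
    using left_half_plane by auto
  have fin: "finite I0" and sub: "I0 \<subseteq> I"
    unfolding I0_def by (rule finite_critical_indices) (auto simp: critical_indices_def)
  have holA: "A \<iota> holomorphic_on U" if "\<iota> \<in> I" for \<iota>
    unfolding A_def by (rule holomorphic_on_integral[OF holomorphic_angular[OF that] open_domain])
  have derA: "(deriv ^^ n) (A \<iota>) 0 = (\<integral>\<nu>. (L1_deriv vol ^^ n) (\<alpha>t \<iota>) 0 \<nu> \<partial>vol)" if "\<iota> \<in> I" for \<iota> n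
    unfolding A_def by (rule higher_deriv_integral[OF holomorphic_angular[OF that] open_domain zero])
  have holH: "H holomorphic_on U"
    unfolding H_def by (rule holomorphic_on_integral[OF holomorphic_L1_part open_domain])
  have derH: "(deriv ^^ n) H 0 = (\<integral>x. (L1_deriv (cone_measure D vol) ^^ n) \<alpha>0 0 x \<partial>cone_measure D vol)" for n
    unfolding H_def by (rule higher_deriv_integral[OF holomorphic_L1_part open_domain zero])
  have R: "?R \<iota> z = (-1) ^ (l \<iota> + 1) * fact (l \<iota>) * A \<iota> z / (of_nat D + d \<iota> + 1 + z) ^ (l \<iota> + 1)" for \<iota> z
    by (simp add: residue_term_def A_def add_ac)
  obtain \<rho> where \<rho>: "\<rho> > 0" "\<And>\<iota>. \<iota> \<in> I - I0 \<Longrightarrow> \<rho> \<le> norm (of_nat D + d \<iota> + 1)"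
    using noncritical_poles_bounded_away unfolding I0_def by blast
  obtain s where s: "s > 0" "cball 0 s \<subseteq> U"
    using open_domain zero open_contains_cball by blast
  \<comment> \<open>Being below \<open>\<rho>\<close> keeps the closed disc away from noncritical
    poles; on the circle, \<open>r > 0\<close> also avoids the critical pole at 0.\<close>
  define r where "r = min s (\<rho> / 2)"
  have r: "r > 0" "cball 0 r \<subseteq> U" "r < \<rho>"
    using s \<rho>(1) by (auto simp: r_def)
  have ballU: "ball 0 r \<subseteq> U"
    using r(2) ball_subset_cball by blast
  have crit: "of_nat D + d \<iota> + 1 = 0" if "\<iota> \<in> I0" for \<iota>
    using that by (simp add: I0_def critical_indices_def)
  have nz: "of_nat D + d \<iota> + 1 + z \<noteq> 0" if "\<iota> \<in> I - I0" "norm z < \<rho>" for \<iota> z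
  proof
    assume "of_nat D + d \<iota> + 1 + z = 0"
    then have "norm (of_nat D + d \<iota> + 1) = norm z"
      by (metis add_eq_0_iff norm_minus_cancel)
    then show False
      using \<rho>(2)[OF that(1)] that(2) by simp
  qed
  have "sphere 0 r \<subseteq> U - (\<lambda>\<iota>. - (of_nat D + d \<iota> + 1)) ` I"
  proof
    fix z :: complex assume z: "z \<in> sphere 0 r"
    then have z': "z \<in> U" "norm z < \<rho>" "z \<noteq> 0"
      using r by auto
    have "of_nat D + d \<iota> + 1 + z \<noteq> 0" if "\<iota> \<in> I" for \<iota>
      using that nz[of \<iota> z] crit[of \<iota>] z' by (cases "\<iota> \<in> I0") auto
    then have "z \<noteq> - (of_nat D + d \<iota> + 1)" if "\<iota> \<in> I" for \<iota>
      using that by force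
    then show "z \<in> U - (\<lambda>\<iota>. - (of_nat D + d \<iota> + 1)) ` I"
      using z'(1) by blast
  qed
  then have ulim: "uniform_limit (sphere 0 r) (\<lambda>F z. \<Sum>\<iota>\<in>F. ?R \<iota> z) (\<lambda>z. \<Sum>\<^sub>\<infinity>\<iota>\<in>I. ?R \<iota> z) (finite_subsets_at_top I)"
    using conv compact_sphere unfolding zeta_series_converges_def by blast
  have holR: "?R \<iota> holomorphic_on (U \<inter> ball 0 \<rho>)" if "\<iota> \<in> I - I0" for \<iota>
    unfolding R using that nz
    by (intro holomorphic_intros holomorphic_on_subset[OF holA]) auto
  from uniform_limit_sum_remove_finite[OF ulim fin sub]
  \<comment> \<open>Only the existence of a limit on the circle matters; inside, the sum is
    identified afterwards as \<open>G\<close>.\<close>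
  obtain g where lim: "uniform_limit (sphere 0 r) (\<lambda>F z. \<Sum>\<iota>\<in>F. ?R \<iota> z) g (finite_subsets_at_top (I - I0))"
    by blast
  have sub': "cball 0 r \<subseteq> U \<inter> ball 0 \<rho>"
    using r by auto
  note series = holomorphic_series_from_sphere[OF holR sub' r(1) lim, folded G_def[abs_def]]
  have b: "b n \<iota> = (deriv ^^ n) (?R \<iota>) 0 / fact n" if "\<iota> \<in> I - I0" for n \<iota>
  proof -
    have "(deriv ^^ n) (?R \<iota>) 0 / fact n = (\<Sum>j=0..n. of_nat (n choose j) *
        ((-1) ^ (l \<iota> + j + 1) * fact (l \<iota> + j) * (deriv ^^ (n - j)) (A \<iota>) 0 / (fact n * (of_nat D + d \<iota> + 1) ^ (l \<iota> + j + 1))))"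
      unfolding R using that nz[OF that, of 0] \<rho>(1)
      by (intro higher_deriv_log_homogeneous_term[OF holA open_domain zero]) auto
    then show ?thesis
      using that by (simp add: b_def derA)
  qed
  have bsum: "(b n has_sum (deriv ^^ n) G 0 / fact n) (I - I0)" for n
  proof -
    have "((\<lambda>\<iota>. (deriv ^^ n) (?R \<iota>) 0 * (1 / fact n)) has_sum (deriv ^^ n) G 0 * (1 / fact n)) (I - I0)"
      by (rule has_sum_cmult_left[OF series(3)])
    then show ?thesis
      using has_sum_cong[of "I - I0" "b n" "\<lambda>\<iota>. (deriv ^^ n) (?R \<iota>) 0 * (1 / fact n)"] by (simp add: b)
  qed
  then show "b n summable_on (I - I0)" for n
    by (auto simp: summable_on_def)
  have infb: "(\<Sum>\<^sub>\<infinity>\<iota>\<in>I - I0. b n \<iota>) = (deriv ^^ n) G 0 / fact n" for n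
    by (rule infsumI[OF bsum])
  have main: "summable (\<lambda>n. a n * z ^ n) \<and>
        summable (\<lambda>n. (\<Sum>\<^sub>\<infinity>\<iota>\<in>I - I0. b n \<iota>) * z ^ n) \<and>
        summable (\<lambda>n. c n * z ^ n) \<and>
        zeta D vol \<alpha>0 I d l \<alpha>t z =
          (\<Sum>\<iota>\<in>I0. \<Sum>n=0..l \<iota>. (-1) ^ (l \<iota> + 1) * fact (l \<iota>) *
              (\<integral>\<nu>. (L1_deriv vol ^^ n) (\<alpha>t \<iota>) 0 \<nu> \<partial>vol) / (fact n * z ^ (l \<iota> + 1 - n)))
          + (\<Sum>n. a n * z ^ n)
          + (\<Sum>n. (\<Sum>\<^sub>\<infinity>\<iota>\<in>I - I0. b n \<iota>) * z ^ n)
          + (\<Sum>n. c n * z ^ n)"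
    if z: "norm z < r" "z \<noteq> 0 \<or> I0 = {}" for z
  proof -
    have zb: "z \<in> ball 0 r"
      using z by simp
    have sa: "(\<lambda>n. a n * z ^ n) sums H z"
      using holomorphic_power_series[OF holomorphic_on_subset[OF holH ballU] zb] by (simp add: derH a_def)
    have sb: "(\<lambda>n. (\<Sum>\<^sub>\<infinity>\<iota>\<in>I - I0. b n \<iota>) * z ^ n) sums G z"
      using holomorphic_power_series[OF series(2) zb] by (simp add: infb)
    define P where "P \<iota> = (\<Sum>n=0..l \<iota>. (-1) ^ (l \<iota> + 1) * fact (l \<iota>) *
              (\<integral>\<nu>. (L1_deriv vol ^^ n) (\<alpha>t \<iota>) 0 \<nu> \<partial>vol) / (fact n * z ^ (l \<iota> + 1 - n)))" for \<iota>
    \<comment> \<open>For a critical index the denominator of the residue term is exactly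
      \<open>z ^ (l \<iota> + 1)\<close>, so \<open>P \<iota>\<close> is its principal part and the
      remainder is a power series.\<close>
    have sc1: "(\<lambda>n. (-1) ^ (l \<iota> + 1) * fact (l \<iota>) *
            (\<integral>\<nu>. (L1_deriv vol ^^ (n + l \<iota> + 1)) (\<alpha>t \<iota>) 0 \<nu> \<partial>vol) / fact (n + l \<iota> + 1) * z ^ n)
        sums (?R \<iota> z - P \<iota>)" if \<iota>: "\<iota> \<in> I0" for \<iota>
    proof -
      have \<iota>I: "\<iota> \<in> I"
        using \<iota> sub by auto
      have z0: "z \<noteq> 0"
        using \<iota> z(2) by auto
      let ?K = "(-1) ^ (l \<iota> + 1) * fact (l \<iota>) :: complex"
      let ?t = "\<lambda>n. (\<integral>\<nu>. (L1_deriv vol ^^ n) (\<alpha>t \<iota>) 0 \<nu> \<partial>vol) / fact n"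
      have "(\<lambda>n. ?t n * z ^ n) sums A \<iota> z"
        using holomorphic_power_series[OF holomorphic_on_subset[OF holA[OF \<iota>I] ballU] zb] by (simp add: derA \<iota>I)
      from sums_mult[OF laurent_tail_sums[OF z0 this, of "l \<iota> + 1"], of ?K]
      have "(\<lambda>n. ?K * (?t (n + (l \<iota> + 1)) * z ^ n)) sums
          (?K * (A \<iota> z / z ^ (l \<iota> + 1) - (\<Sum>n<l \<iota> + 1. ?t n / z ^ (l \<iota> + 1 - n))))" .
      also have "?K * (A \<iota> z / z ^ (l \<iota> + 1) - (\<Sum>n<l \<iota> + 1. ?t n / z ^ (l \<iota> + 1 - n)))
          = ?K * (A \<iota> z / z ^ (l \<iota> + 1)) - ?K * (\<Sum>n<l \<iota> + 1. ?t n / z ^ (l \<iota> + 1 - n))"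
        by (rule right_diff_distrib)
      also have "?K * (A \<iota> z / z ^ (l \<iota> + 1)) = ?R \<iota> z"
        using crit[OF \<iota>] by (simp add: R)
      also have "?K * (\<Sum>n<l \<iota> + 1. ?t n / z ^ (l \<iota> + 1 - n)) = P \<iota>"
        unfolding P_def sum_distrib_left by (rule sum.cong) auto
      finally show ?thesis
        by (simp only: times_divide_eq_right times_divide_eq_left mult.assoc add.assoc)
    qed
    have sc: "(\<lambda>n. c n * z ^ n) sums (\<Sum>\<iota>\<in>I0. ?R \<iota> z - P \<iota>)"
    proof -
      have "c n * z ^ n = (\<Sum>\<iota>\<in>I0. (-1) ^ (l \<iota> + 1) * fact (l \<iota>) *
            (\<integral>\<nu>. (L1_deriv vol ^^ (n + l \<iota> + 1)) (\<alpha>t \<iota>) 0 \<nu> \<partial>vol) / fact (n + l \<iota> + 1) * z ^ n)" for n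
        by (simp only: c_def I0_def sum_distrib_right)
      then show ?thesis
        using sums_sum[of I0, OF sc1] by simp
    qed
    have "((\<lambda>\<iota>. ?R \<iota> z) has_sum (G z + (\<Sum>\<iota>\<in>I0. ?R \<iota> z))) ((I - I0) \<union> I0)"
      using series(1)[of z] zb fin by (intro has_sum_Un_disjoint has_sum_finite) (auto simp: G_def)
    moreover have "(I - I0) \<union> I0 = I"
      using sub by auto
    ultimately have "(\<Sum>\<^sub>\<infinity>\<iota>\<in>I. ?R \<iota> z) = G z + (\<Sum>\<iota>\<in>I0. ?R \<iota> z)"
      by (intro infsumI) simp
    \<comment> \<open>Adding and subtracting \<open>P \<iota>\<close> separates the polar part from
      the series \<open>c\<close>.\<close>
    then have "zeta D vol \<alpha>0 I d l \<alpha>t z = (\<Sum>\<iota>\<in>I0. P \<iota>) + H z + G z + (\<Sum>\<iota>\<in>I0. ?R \<iota> z - P \<iota>)"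
      by (simp add: zeta_def H_def sum_subtractf)
    also have "\<dots> = (\<Sum>\<iota>\<in>I0. P \<iota>) + (\<Sum>n. a n * z ^ n)
        + (\<Sum>n. (\<Sum>\<^sub>\<infinity>\<iota>\<in>I - I0. b n \<iota>) * z ^ n) + (\<Sum>n. c n * z ^ n)"
      unfolding sums_unique[OF sa] sums_unique[OF sb] sums_unique[OF sc] ..
    finally show ?thesis
      unfolding P_def by (intro conjI sums_summable[OF sa] sums_summable[OF sb] sums_summable[OF sc])
  qed
  show "\<exists>\<epsilon>>0. \<forall>z. norm z < \<epsilon> \<and> (z \<noteq> 0 \<or> I0 = {}) \<longrightarrow>
        summable (\<lambda>n. a n * z ^ n) \<and>
        summable (\<lambda>n. (\<Sum>\<^sub>\<infinity>\<iota>\<in>I - I0. b n \<iota>) * z ^ n) \<and>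
        summable (\<lambda>n. c n * z ^ n) \<and>
        zeta D vol \<alpha>0 I d l \<alpha>t z =
          (\<Sum>\<iota>\<in>I0. \<Sum>n=0..l \<iota>. (-1) ^ (l \<iota> + 1) * fact (l \<iota>) *
              (\<integral>\<nu>. (L1_deriv vol ^^ n) (\<alpha>t \<iota>) 0 \<nu> \<partial>vol) / (fact n * z ^ (l \<iota> + 1 - n)))
          + (\<Sum>n. a n * z ^ n)
          + (\<Sum>n. (\<Sum>\<^sub>\<infinity>\<iota>\<in>I - I0. b n \<iota>) * z ^ n)
          + (\<Sum>n. c n * z ^ n)"
    by (intro exI[of _ r] conjI[OF r(1)] allI impI, elim conjE) (rule main)
qed

text \<open>At \<open>r = 1\<close> the power of \<open>r\<close> is 1, and \<open>ln 1 ^ 0\<close>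
  is 1 as well; with a positive logarithmic order the restriction would vanish instead.\<close>

lemma higher_L1_deriv_restriction:
  assumes "\<iota> \<in> I" "l \<iota> = 0" "z \<in> U"
  shows "(L1_deriv vol ^^ n) (\<lambda>z \<nu>. \<alpha>s \<iota> z (1, \<nu>)) z = (L1_deriv vol ^^ n) (\<alpha>t \<iota>) z"
  using assms by (intro higher_L1_deriv_cong[OF open_domain]) (auto simp: log_homogeneous)

corollary zeta_laurent_expansion_poly_homogeneous:
  assumes conv: "zeta_series_converges D vol U I d l \<alpha>t" and l: "\<And>\<iota>. \<iota> \<in> I \<Longrightarrow> l \<iota> = 0"
  defines "I0 \<equiv> critical_indices D I d"
    and "a \<equiv> \<lambda>n. (\<integral>x. (L1_deriv (cone_measure D vol) ^^ n) \<alpha>0 0 x \<partial>cone_measure D vol) / fact n"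
    and "b \<equiv> \<lambda>n \<iota>. \<Sum>j=0..n. of_nat (n choose j) *
            ((-1) ^ (j + 1) * fact j *
               (\<integral>\<nu>. (L1_deriv vol ^^ (n - j)) (\<lambda>z \<nu>. \<alpha>s \<iota> z (1, \<nu>)) 0 \<nu> \<partial>vol)
             / (fact n * (of_nat D + d \<iota> + 1) ^ (j + 1)))"
    and "c \<equiv> \<lambda>n. \<Sum>\<iota>\<in>critical_indices D I d.
            - (\<integral>\<nu>. (L1_deriv vol ^^ (n + 1)) (\<lambda>z \<nu>. \<alpha>s \<iota> z (1, \<nu>)) 0 \<nu> \<partial>vol) / fact (n + 1)"
  shows "\<And>n. b n summable_on (I - I0)"
    and "\<exists>\<epsilon>>0. \<forall>z. norm z < \<epsilon> \<and> (z \<noteq> 0 \<or> I0 = {}) \<longrightarrow>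
        summable (\<lambda>n. a n * z ^ n) \<and>
        summable (\<lambda>n. (\<Sum>\<^sub>\<infinity>\<iota>\<in>I - I0. b n \<iota>) * z ^ n) \<and>
        summable (\<lambda>n. c n * z ^ n) \<and>
        zeta D vol \<alpha>0 I d l \<alpha>t z =
          (\<Sum>\<iota>\<in>I0. - (\<integral>\<nu>. \<alpha>s \<iota> 0 (1, \<nu>) \<partial>vol) / z)
          + (\<Sum>n. a n * z ^ n)
          + (\<Sum>n. (\<Sum>\<^sub>\<infinity>\<iota>\<in>I - I0. b n \<iota>) * z ^ n)
          + (\<Sum>n. c n * z ^ n)"
proof -
  have zero: "0 \<in> U"
    using left_half_plane by auto
  have sub: "\<iota> \<in> I" if "\<iota> \<in> I0" for \<iota>
    using that by (simp add: I0_def critical_indices_def)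
  note restr = higher_L1_deriv_restriction[OF _ l zero]
  \<comment> \<open>The general coefficients agree with the specialised ones only for indices in
    \<open>I\<close>, where \<open>l\<close> vanishes; hence the congruence rules below.\<close>
  let ?b' = "\<lambda>n \<iota>. (\<Sum>j=0..n. of_nat (n choose j) *
            ((-1) ^ (l \<iota> + j + 1) * fact (l \<iota> + j) *
               (\<integral>\<nu>. (L1_deriv vol ^^ (n - j)) (\<alpha>t \<iota>) 0 \<nu> \<partial>vol)
             / (fact n * (of_nat D + d \<iota> + 1) ^ (l \<iota> + j + 1))))"
  let ?c' = "\<lambda>n. (\<Sum>\<iota>\<in>I0. (-1) ^ (l \<iota> + 1) * fact (l \<iota>) *
            (\<integral>\<nu>. (L1_deriv vol ^^ (n + l \<iota> + 1)) (\<alpha>t \<iota>) 0 \<nu> \<partial>vol) / fact (n + l \<iota> + 1))"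
  note expansion = zeta_laurent_expansion[OF conv, folded I0_def]
  have b: "?b' n \<iota> = b n \<iota>" if "\<iota> \<in> I - I0" for n \<iota>
    using that l[of \<iota>] restr[of \<iota>] by (simp add: b_def)
  have "?b' n summable_on (I - I0) \<longleftrightarrow> b n summable_on (I - I0)" for n
    by (rule summable_on_cong) (rule b)
  with expansion(1) show "b n summable_on (I - I0)" for n
    by blast
  have infb: "(\<Sum>\<^sub>\<infinity>\<iota>\<in>I - I0. ?b' n \<iota>) = (\<Sum>\<^sub>\<infinity>\<iota>\<in>I - I0. b n \<iota>)" for n
    by (rule infsum_cong) (rule b)
  have c: "?c' n = c n" for n
    unfolding c_def I0_def[symmetric]
  proof (rule sum.cong[OF refl])
    fix \<iota> assume "\<iota> \<in> I0"
    then have "\<iota> \<in> I"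
      by (rule sub)
    then show "(-1) ^ (l \<iota> + 1) * fact (l \<iota>) *
            (\<integral>\<nu>. (L1_deriv vol ^^ (n + l \<iota> + 1)) (\<alpha>t \<iota>) 0 \<nu> \<partial>vol) / fact (n + l \<iota> + 1)
          = - (\<integral>\<nu>. (L1_deriv vol ^^ (n + 1)) (\<lambda>z \<nu>. \<alpha>s \<iota> z (1, \<nu>)) 0 \<nu> \<partial>vol) / fact (n + 1)"
      unfolding restr[OF \<open>\<iota> \<in> I\<close> \<open>\<iota> \<in> I\<close>] by (simp add: l del: funpow.simps fact_Suc)
  qed
  have polar: "(\<Sum>\<iota>\<in>I0. \<Sum>n=0..l \<iota>. (-1) ^ (l \<iota> + 1) * fact (l \<iota>) *
              (\<integral>\<nu>. (L1_deriv vol ^^ n) (\<alpha>t \<iota>) 0 \<nu> \<partial>vol) / (fact n * z ^ (l \<iota> + 1 - n)))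
      = (\<Sum>\<iota>\<in>I0. - (\<integral>\<nu>. \<alpha>s \<iota> 0 (1, \<nu>) \<partial>vol) / z)" for z
    using l sub zero by (intro sum.cong refl) (simp add: log_homogeneous)
  show "\<exists>\<epsilon>>0. \<forall>z. norm z < \<epsilon> \<and> (z \<noteq> 0 \<or> I0 = {}) \<longrightarrow>
        summable (\<lambda>n. a n * z ^ n) \<and>
        summable (\<lambda>n. (\<Sum>\<^sub>\<infinity>\<iota>\<in>I - I0. b n \<iota>) * z ^ n) \<and>
        summable (\<lambda>n. c n * z ^ n) \<and>
        zeta D vol \<alpha>0 I d l \<alpha>t z =
          (\<Sum>\<iota>\<in>I0. - (\<integral>\<nu>. \<alpha>s \<iota> 0 (1, \<nu>) \<partial>vol) / z)
          + (\<Sum>n. a n * z ^ n)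
          + (\<Sum>n. (\<Sum>\<^sub>\<infinity>\<iota>\<in>I - I0. b n \<iota>) * z ^ n)
          + (\<Sum>n. c n * z ^ n)"
    using expansion(2) unfolding infb c polar a_def .
qed

end

text \<open>Finiteness of \<open>I0\<close> and the summability clauses give the identities their
  content: without convergence, the sums would denote default values.\<close>

theorem theorem2p15:
  fixes \<A> :: "('m::t2_space set \<times> ('m \<Rightarrow> nat \<Rightarrow> real)) set"
    and D :: nat
    and vol :: "'m measure"
    and U :: "complex set"
    and \<alpha> \<alpha>0 :: "complex \<Rightarrow> real \<times> 'm \<Rightarrow> complex"
    and I :: "nat set"
    and \<alpha>s :: "nat \<Rightarrow> complex \<Rightarrow> real \<times> 'm \<Rightarrow> complex"
    and d :: "nat \<Rightarrow> complex"
    and l :: "nat \<Rightarrow> nat"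
    and \<alpha>t :: "nat \<Rightarrow> complex \<Rightarrow> 'm \<Rightarrow> complex"
  assumes "compact_oriented_manifold D \<A>"
    and "volume_measure D \<A> vol"
    and "gauged_poly_log_homogeneous D vol U \<alpha> \<alpha>0 I \<alpha>s d l \<alpha>t"
    and "zeta_series_converges D vol U I d l \<alpha>t"
  shows "(let
      I0 = critical_indices D I d;
      a = (\<lambda>n. (\<integral>x. (L1_deriv (cone_measure D vol) ^^ n) \<alpha>0 0 x \<partial>cone_measure D vol) / fact n);
      b = (\<lambda>n \<iota>. \<Sum>j=0..n. of_nat (n choose j) *
            ((-1) ^ (l \<iota> + j + 1) * fact (l \<iota> + j) *
               (\<integral>\<nu>. (L1_deriv vol ^^ (n - j)) (\<alpha>t \<iota>) 0 \<nu> \<partial>vol)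
             / (fact n * (of_nat D + d \<iota> + 1) ^ (l \<iota> + j + 1))));
      c = (\<lambda>n. \<Sum>\<iota>\<in>I0. (-1) ^ (l \<iota> + 1) * fact (l \<iota>) *
            (\<integral>\<nu>. (L1_deriv vol ^^ (n + l \<iota> + 1)) (\<alpha>t \<iota>) 0 \<nu> \<partial>vol) / fact (n + l \<iota> + 1))
    in finite I0 \<and> (\<forall>n. b n summable_on (I - I0)) \<and>
      (\<exists>\<epsilon>>0. \<forall>z. norm z < \<epsilon> \<and> (z \<noteq> 0 \<or> I0 = {}) \<longrightarrow>
        summable (\<lambda>n. a n * z ^ n) \<and>
        summable (\<lambda>n. (\<Sum>\<^sub>\<infinity>\<iota>\<in>I - I0. b n \<iota>) * z ^ n) \<and>
        summable (\<lambda>n. c n * z ^ n) \<and>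
        zeta D vol \<alpha>0 I d l \<alpha>t z =
          (\<Sum>\<iota>\<in>I0. \<Sum>n=0..l \<iota>. (-1) ^ (l \<iota> + 1) * fact (l \<iota>) *
              (\<integral>\<nu>. (L1_deriv vol ^^ n) (\<alpha>t \<iota>) 0 \<nu> \<partial>vol) / (fact n * z ^ (l \<iota> + 1 - n)))
          + (\<Sum>n. a n * z ^ n)
          + (\<Sum>n. (\<Sum>\<^sub>\<infinity>\<iota>\<in>I - I0. b n \<iota>) * z ^ n)
          + (\<Sum>n. c n * z ^ n)))
    \<and>
    ((\<forall>\<iota>\<in>I. l \<iota> = 0) \<longrightarrow>
    (let
      I0 = critical_indices D I d;
      a = (\<lambda>n. (\<integral>x. (L1_deriv (cone_measure D vol) ^^ n) \<alpha>0 0 x \<partial>cone_measure D vol) / fact n);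
      b = (\<lambda>n \<iota>. \<Sum>j=0..n. of_nat (n choose j) *
            ((-1) ^ (j + 1) * fact j *
               (\<integral>\<nu>. (L1_deriv vol ^^ (n - j)) (\<lambda>z \<nu>. \<alpha>s \<iota> z (1, \<nu>)) 0 \<nu> \<partial>vol)
             / (fact n * (of_nat D + d \<iota> + 1) ^ (j + 1))));
      c = (\<lambda>n. \<Sum>\<iota>\<in>I0.
            - (\<integral>\<nu>. (L1_deriv vol ^^ (n + 1)) (\<lambda>z \<nu>. \<alpha>s \<iota> z (1, \<nu>)) 0 \<nu> \<partial>vol) / fact (n + 1))
    in (\<forall>n. b n summable_on (I - I0)) \<and>
      (\<exists>\<epsilon>>0. \<forall>z. norm z < \<epsilon> \<and> (z \<noteq> 0 \<or> I0 = {}) \<longrightarrow>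
        summable (\<lambda>n. a n * z ^ n) \<and>
        summable (\<lambda>n. (\<Sum>\<^sub>\<infinity>\<iota>\<in>I - I0. b n \<iota>) * z ^ n) \<and>
        summable (\<lambda>n. c n * z ^ n) \<and>
        zeta D vol \<alpha>0 I d l \<alpha>t z =
          (\<Sum>\<iota>\<in>I0. - (\<integral>\<nu>. \<alpha>s \<iota> 0 (1, \<nu>) \<partial>vol) / z)
          + (\<Sum>n. a n * z ^ n)
          + (\<Sum>n. (\<Sum>\<^sub>\<infinity>\<iota>\<in>I - I0. b n \<iota>) * z ^ n)
          + (\<Sum>n. c n * z ^ n))))"
proof -
  interpret gauged_poly_log_homogeneous D vol U \<alpha> \<alpha>0 I \<alpha>s d l \<alpha>t
    by fact
  note expansion = zeta_laurent_expansion[OF assms(4)]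
  note expansion' = zeta_laurent_expansion_poly_homogeneous[OF assms(4)]
  show ?thesis
    unfolding Let_def
  proof (rule conjI, goal_cases)
    case 1
    show ?case
      by (intro conjI[OF finite_critical_indices] conjI[OF allI[OF expansion(1)] expansion(2)])
  next
    case 2
    show ?case
      by (rule impI, rule conjI[OF allI[OF expansion'(1)] expansion'(2)]) simp_all
  qed
qed

end
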